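(* Let $-A$ generate a positive compact $C_0$-semigroup $T(t)$ $(t\ge 0)$ on $E$ which is exponentially stable, i.e. $\nu_0<0$. Let $F:\mathbb{R}\times K\times K\to K$ be continuous and $\omega$-periodic in $t$. Assume: (H1) there are positive constants $C_1,C_2$ with $C_1+C_2\in(0,|\nu_0|)$ and a function $h_0\in C_\omega(\mathbb{R},K)$ such that $$F(t,x,y)\le C_1x+C_2y+h_0(t),\qquad t\in\mathbb{R},\ x,y\in K.$$ Then the delay evolution equation $u'(t)+Au(t)=F(t,u(t),u(t-\tau))$, $t\in\mathbb{R}$, has at least one positive $\omega$-periodic mild solution.
   Context: $E$ is a real Banach space ordered by a closed convex cone $K$ (the positive cone): $x\le y$ iff $y-x\in K$; $\theta$ denotes the zero vector. $K$ is normal: there is $N>0$ such that $\theta\le x\le y$ implies $\|x\|\le N\|y\|$. $A:D(A)\subset E\to E$ is a closed linear operator such that $-A$ generates a $C_0$-semigroup $T(t)$, $t\ge0$. The semigroup is positive if $T(t)K\subset K$ for all $t\ge0$, and compact if $T(t)$ is a compact operator for every $t>0$. Its growth exponent is $\nu_0=\inf\{\gamma\in\mathbb{R}: \exists M>0 \text{ with } \|T(t)\|\le Me^{\gamma t}\ \forall t\ge0\}$; the semigroup is exponentially stable if $\nu_0<0$. $\tau>0$ (the delay) and $\omega>0$ (the period) are fixed. $C_\omega(\mathbb{R},E)$ is the Banach space of continuous $\omega$-periodic functions $\mathbb{R}\to E$ with norm $\|u\|_C=\max_{t\in[0,\omega]}\|u(t)\|$, and $C_\omega(\mathbb{R},K)$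 is its subset of functions with values in $K$. A positive $\omega$-periodic mild solution of $u'(t)+Au(t)=F(t,u(t),u(t-\tau))$, $t\in\mathbb{R}$, is a function $u\in C_\omega(\mathbb{R},K)$ such that $u(t)=T(t-a)u(a)+\int_a^tT(t-s)F(s,u(s),u(s-\tau))\,ds$ for all $a\le t$; when $T$ is exponentially stable this is equivalent to $u(t)=(I-T(\omega))^{-1}\int_{t-\omega}^tT(t-s)F(s,u(s),u(s-\tau))\,ds$ for all $t\in\mathbb{R}$. *)

theory Defs
  imports "HOL-Analysis.Analysis"
begin

definition cone_le :: "'a::real_vector set \<Rightarrow> 'a \<Rightarrow> 'a \<Rightarrow> bool" where
  "cone_le K x y \<longleftrightarrow> y - x \<in> K"

definition closed_convex_cone :: "'a::real_normed_vector set \<Rightarrow> bool" where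
  "closed_convex_cone K \<longleftrightarrow> closed K \<and> convex K \<and> cone K \<and> K \<noteq> {}"

definition normal_cone :: "'a::real_normed_vector set \<Rightarrow> bool" where
  "normal_cone K \<longleftrightarrow> (\<exists>N>0. \<forall>x y. cone_le K 0 x \<and> cone_le K x y \<longrightarrow> norm x \<le> N * norm y)"

definition C0_semigroup :: "(real \<Rightarrow> 'a::banach \<Rightarrow>\<^sub>L 'a) \<Rightarrow> bool" where
  "C0_semigroup T \<longleftrightarrow> T 0 = id_blinfun
     \<and> (\<forall>t\<ge>0. \<forall>s\<ge>0. T (t + s) = T t o\<^sub>L T s)
     \<and> (\<forall>x. continuous_on {0..} (\<lambda>t. blinfun_apply (T t) x))"

definition is_generator :: "(real \<Rightarrow> 'a::banach \<Rightarrow>\<^sub>L 'a) \<Rightarrow> ('a \<Rightarrow> 'a) \<Rightarrow> 'a set \<Rightarrow> bool" where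
  "is_generator T G D \<longleftrightarrow>
     D = {x. \<exists>y. ((\<lambda>h. (1 / h) *\<^sub>R (blinfun_apply (T h) x - x)) \<longlongrightarrow> y) (at_right 0)}
     \<and> (\<forall>x\<in>D. ((\<lambda>h. (1 / h) *\<^sub>R (blinfun_apply (T h) x - x)) \<longlongrightarrow> G x) (at_right 0))"

definition closed_linear_operator :: "('a::real_normed_vector \<Rightarrow> 'a) \<Rightarrow> 'a set \<Rightarrow> bool" where
  "closed_linear_operator A D \<longleftrightarrow> subspace D
     \<and> (\<forall>x\<in>D. \<forall>y\<in>D. \<forall>c. A (x + c *\<^sub>R y) = A x + c *\<^sub>R A y)
     \<and> closed {(x, A x) | x. x \<in> D}"

definition positive_semigroup :: "(real \<Rightarrow> 'a::banach \<Rightarrow>\<^sub>L 'a) \<Rightarrow> 'a set \<Rightarrow> bool" where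
  "positive_semigroup T K \<longleftrightarrow> (\<forall>t\<ge>0. blinfun_apply (T t) ` K \<subseteq> K)"

definition compact_operator :: "('a::real_normed_vector \<Rightarrow>\<^sub>L 'b::real_normed_vector) \<Rightarrow> bool" where
  "compact_operator L \<longleftrightarrow> (\<forall>B. bounded B \<longrightarrow> compact (closure (blinfun_apply L ` B)))"

definition compact_semigroup :: "(real \<Rightarrow> 'a::banach \<Rightarrow>\<^sub>L 'a) \<Rightarrow> bool" where
  "compact_semigroup T \<longleftrightarrow> (\<forall>t>0. compact_operator (T t))"

text \<open>Growth exponent nu_0, as an extended real (may be -infinity).\<close>
definition growth_bound :: "(real \<Rightarrow> 'a::banach \<Rightarrow>\<^sub>L 'a) \<Rightarrow> ereal" where
  "growth_bound T = Inf {ereal \<gamma> | \<gamma>. \<exists>M>0. \<forall>t\<ge>0. norm (T t) \<le> M * exp (\<gamma> * t)}"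

definition positive_periodic_mild_solution ::
  "(real \<Rightarrow> 'a::banach \<Rightarrow>\<^sub>L 'a) \<Rightarrow> 'a set \<Rightarrow> (real \<Rightarrow> 'a \<Rightarrow> 'a \<Rightarrow> 'a) \<Rightarrow> real \<Rightarrow> real \<Rightarrow> (real \<Rightarrow> 'a) \<Rightarrow> bool" where
  "positive_periodic_mild_solution T K F \<tau> \<omega> u \<longleftrightarrow>
     continuous_on UNIV u \<and> (\<forall>t. u (t + \<omega>) = u t) \<and> (\<forall>t. u t \<in> K)
     \<and> (\<forall>a t. a \<le> t \<longrightarrow>
          ((\<lambda>s. blinfun_apply (T (t - s)) (F s (u s) (u (s - \<tau>))))
             has_integral (u t - blinfun_apply (T (t - a)) (u a))) {a..t})"

end

theory Submission
  imports Defs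
begin

text \<open>
  For \<open>\<omega>\<close>-periodic \<open>f\<close> the equation \<open>u' + A u = f\<close> has a unique \<open>\<omega>\<close>-periodic mild solution \<open>S f\<close>, and
  \<open>S\<close> is a positive operator. Choose \<open>\<gamma>\<close> with \<open>C1 + C2 < \<gamma> < -\<nu>\<^sub>0\<close>. In the equivalent norm
  \<open>sup\<^sub>r exp (\<gamma> r) \<parallel>T r x\<parallel>\<close> the operator \<open>S\<close> has norm at most \<open>1/\<gamma>\<close>, so the linear majorant
  \<open>v = S (C1 v + C2 v(\<cdot> - \<tau>) + h0)\<close> is solved by a positive periodic \<open>v\<close>. By (H1), the solution operator
  \<open>Q u = S (F(\<cdot>, u, u(\<cdot> - \<tau>)))\<close> maps the order interval \<open>{u. 0 \<le> u \<le> v}\<close> into itself; by normality of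
  the cone \<open>F\<close> is bounded along it, so compactness of the semigroup makes the image of \<open>Q\<close> totally bounded.
  Schauder's theorem, which follows from Kuhn's combinatorial lemma via Brouwer's theorem on cubes, gives a
  fixed point.
\<close>

section \<open>The Brouwer and Schauder fixed point theorems\<close>

text \<open>The dimension is a number and not a type, because the proof of Schauder's theorem
  chooses it as the size of a finite net. Pinning the remaining coordinates to 0 keeps the cube
  compact in the product topology.\<close>

definition nat_cube :: "nat \<Rightarrow> (nat \<Rightarrow> real) set" where
  "nat_cube n = {x. (\<forall>i<n. 0 \<le> x i \<and> x i \<le> 1) \<and> (\<forall>i\<ge>n. x i = 0)}"

text \<open>Tychonoff: the cube is a product of factors \<open>{0..1}\<close> and
  \<open>{0}\<close>.\<close>

lemma compact_nat_cube: "compact (nat_cube n)"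
proof -
  have "nat_cube n = PiE UNIV (\<lambda>i. if i < n then {0..1} else {0})"
    unfolding nat_cube_def PiE_UNIV_domain Pi_def
    by (rule Collect_cong) (smt (verit) UNIV_I atLeastAtMost_iff not_less singleton_iff)
  moreover have "compactin (product_topology (\<lambda>_. euclidean) UNIV) (PiE UNIV (\<lambda>i::nat. if i < n then {0..1::real} else {0}))"
    unfolding compactin_PiE by auto
  ultimately show ?thesis
    by (metis compactin_euclidean_iff euclidean_product_topology)
qed

lemma tendsto_fun_iff:
  fixes X :: "nat \<Rightarrow> 'a \<Rightarrow> 'b::topological_space"
  shows "X \<longlonglongrightarrow> l \<longleftrightarrow> (\<forall>i. (\<lambda>m. X m i) \<longlonglongrightarrow> l i)"
proof -
  have "limitin (product_topology (\<lambda>_. euclidean) UNIV) X l sequentially \<longleftrightarrow> (\<forall>i. limitin euclidean (\<lambda>m. X m i) (l i) sequentially)"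
    by (subst limitin_componentwise) auto
  then show ?thesis
    by (simp add: euclidean_product_topology)
qed

text \<open>Kuhn's lemma gives, for every mesh, a grid cell on whose vertices each coordinate label
  takes both values. Label 0 means that \<open>f\<close> does not decrease the coordinate, label 1
  that it does not increase it, so a limit point of such cells is fixed.\<close>

lemma brouwer_nat_cube:
  assumes cont: "continuous_on (nat_cube n) f" and maps: "f \<in> nat_cube n \<rightarrow> nat_cube n"
  obtains x where "x \<in> nat_cube n" "f x = x"
proof -
  obtain label where label:
    "\<And>x i. label x i \<le> (1::nat)"
    "\<And>x i. x \<in> nat_cube n \<Longrightarrow> i < n \<Longrightarrow> x i = 0 \<Longrightarrow> label x i = 0"
    "\<And>x i. x \<in> nat_cube n \<Longrightarrow> i < n \<Longrightarrow> x i = 1 \<Longrightarrow> label x i = 1"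
    "\<And>x i. x \<in> nat_cube n \<Longrightarrow> i < n \<Longrightarrow> label x i = 0 \<Longrightarrow> x i \<le> f x i"
    "\<And>x i. x \<in> nat_cube n \<Longrightarrow> i < n \<Longrightarrow> label x i = 1 \<Longrightarrow> f x i \<le> x i"
  proof -
    have "\<forall>x. x \<in> nat_cube n \<longrightarrow> f x \<in> nat_cube n"
      "\<forall>x. x \<in> nat_cube n \<longrightarrow> (\<forall>i. i < n \<longrightarrow> 0 \<le> x i \<and> x i \<le> 1)"
      using maps by (auto simp: nat_cube_def)
    from kuhn_labelling_lemma'[OF this] show ?thesis
      using that by blast
  qed
  \<comment> \<open>Scales the integer grid with coordinates up to \<open>Suc m\<close> into the
    cube; \<open>Suc m\<close> keeps the mesh defined at \<open>m = 0\<close>.\<close>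
  define sc where "sc m y = (\<lambda>i. if i < n then real (y i) / real (Suc m) else 0)" for m and y :: "nat \<Rightarrow> nat"
  have sc_cube: "sc m y \<in> nat_cube n" if "\<forall>i<n. y i \<le> Suc m" for m y
    using that by (auto simp: sc_def nat_cube_def divide_le_eq simp del: of_nat_Suc)
  \<comment> \<open>The vertices of the grid cell with lowest corner \<open>q\<close>.\<close>
  define near where "near q y \<longleftrightarrow> (\<forall>j<n. q j \<le> y j \<and> y j \<le> q j + 1)" for q y :: "nat \<Rightarrow> nat"
  have "\<exists>q. (\<forall>i<n. q i < Suc m) \<and>
          (\<forall>i<n. \<exists>r s. near q r \<and> near q s \<and> label (sc m r) i \<noteq> label (sc m s) i)" for m
  proof (rule kuhn_lemma[of "Suc m" n "\<lambda>y. label (sc m y)"])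
    show "\<forall>x. (\<forall>i<n. x i \<le> Suc m) \<longrightarrow> (\<forall>i<n. label (sc m x) i = 0 \<or> label (sc m x) i = 1)"
      using label(1) by (metis less_one linorder_not_le order_antisym_conv order_less_imp_le)
    show "\<forall>x. (\<forall>i<n. x i \<le> Suc m) \<longrightarrow> (\<forall>i<n. x i = 0 \<longrightarrow> label (sc m x) i = 0)"
      by (intro allI impI label(2) sc_cube) (auto simp: sc_def)
    show "\<forall>x. (\<forall>i<n. x i \<le> Suc m) \<longrightarrow> (\<forall>i<n. x i = Suc m \<longrightarrow> label (sc m x) i = 1)"
      by (intro allI impI label(3) sc_cube) (auto simp: sc_def)
  qed (auto simp: near_def)
  then have "\<exists>q. \<forall>m. (\<forall>i<n. q m i < Suc m) \<and>
          (\<forall>i<n. \<exists>r s. near (q m) r \<and> near (q m) s \<and> label (sc m r) i \<noteq> label (sc m s) i)"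
    by (intro choice) blast
  then obtain q where q: "\<And>m. \<forall>i<n. q m i < Suc m"
    and rs: "\<And>m i. i < n \<Longrightarrow> \<exists>r s. near (q m) r \<and> near (q m) s \<and> label (sc m r) i \<noteq> label (sc m s) i"
    by blast
  have "(\<exists>r. near (q m) r \<and> label (sc m r) i = 0) \<and> (\<exists>s. near (q m) s \<and> label (sc m s) i = 1)" if "i < n" for m i
  proof -
    obtain r s where "near (q m) r" "near (q m) s" "label (sc m r) i \<noteq> label (sc m s) i"
      using rs[OF \<open>i < n\<close>] by blast
    moreover from this(3) have "label (sc m r) i = 0 \<and> label (sc m s) i = 1 \<or> label (sc m s) i = 0 \<and> label (sc m r) i = 1"
      using label(1)[of "sc m r" i] label(1)[of "sc m s" i] by linarith
    ultimately show ?thesis by blast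
  qed
  then have "\<forall>i m. \<exists>r. i < n \<longrightarrow> near (q m) r \<and> label (sc m r) i = 0"
    and "\<forall>i m. \<exists>s. i < n \<longrightarrow> near (q m) s \<and> label (sc m s) i = 1"
    by blast+
  then obtain r s where r: "\<And>i m. i < n \<Longrightarrow> near (q m) (r i m) \<and> label (sc m (r i m)) i = 0"
    and s: "\<And>i m. i < n \<Longrightarrow> near (q m) (s i m) \<and> label (sc m (s i m)) i = 1"
    unfolding choice_iff by blast
  have near_cube: "sc m y \<in> nat_cube n" if "near (q m) y" for m y
  proof (intro sc_cube allI impI)
    fix i assume "i < n"
    then have "q m i < Suc m" "y i \<le> q m i + 1"
      using q[of m] that unfolding near_def by blast+
    then show "y i \<le> Suc m" by linarith
  qed
  define X where "X m = sc m (q m)" for m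
  have "\<forall>m. X m \<in> nat_cube n"
    unfolding X_def by (intro allI near_cube) (simp add: near_def)
  then obtain z k where z: "z \<in> nat_cube n" and k: "strict_mono k" and lim: "(X \<circ> k) \<longlonglongrightarrow> z"
    using compact_imp_seq_compact[OF compact_nat_cube[of n]] by (metis seq_compactE)
  \<comment> \<open>The mesh tends to 0, so every choice of vertices of the selected cells has the
    same limit as the corners.\<close>
  have lim_near: "(\<lambda>m. sc (k m) (y (k m))) \<longlonglongrightarrow> z" if y: "\<And>m. near (q m) (y m)" for y
    unfolding tendsto_fun_iff
  proof
    fix j
    have "(\<lambda>m. sc (k m) (y (k m)) j - sc (k m) (q (k m)) j) \<longlonglongrightarrow> 0"
    proof (rule tendsto_sandwich[of "\<lambda>_. 0" _ _ "\<lambda>m. inverse (real (Suc (k m)))"])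
      show "\<forall>\<^sub>F m in sequentially. 0 \<le> sc (k m) (y (k m)) j - sc (k m) (q (k m)) j"
        using y by (auto simp: sc_def divide_right_mono near_def)
      have "sc m (y m) j - sc m (q m) j \<le> inverse (real (Suc m))" for m
      proof (cases "j < n")
        case True
        then have "real (y m j) \<le> real (q m j) + 1"
          using y[of m] unfolding near_def by (metis of_nat_1 of_nat_add of_nat_mono)
        then have "(real (y m j) - real (q m j)) / real (Suc m) \<le> 1 / real (Suc m)"
          by (intro divide_right_mono) auto
        with True show ?thesis
          by (simp add: sc_def diff_divide_distrib inverse_eq_divide)
      qed (simp add: sc_def)
      then show "\<forall>\<^sub>F m in sequentially. sc (k m) (y (k m)) j - sc (k m) (q (k m)) j \<le> inverse (real (Suc (k m)))"
        by simp
      show "(\<lambda>m. inverse (real (Suc (k m)))) \<longlonglongrightarrow> 0"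
        using LIMSEQ_subseq_LIMSEQ[OF LIMSEQ_inverse_real_of_nat k] by (simp add: o_def)
    qed simp
    moreover have "(\<lambda>m. sc (k m) (q (k m)) j) \<longlonglongrightarrow> z j"
      using lim by (simp add: tendsto_fun_iff o_def X_def)
    ultimately show "(\<lambda>m. sc (k m) (y (k m)) j) \<longlonglongrightarrow> z j"
      using tendsto_add by fastforce
  qed
  have f_lim: "(\<lambda>m. f (sc (k m) (y (k m))) i) \<longlonglongrightarrow> f z i" "(\<lambda>m. sc (k m) (y (k m)) i) \<longlonglongrightarrow> z i"
    if "\<And>m. near (q m) (y m)" for y i
  proof -
    have "(\<lambda>m. f (sc (k m) (y (k m)))) \<longlonglongrightarrow> f z"
      using continuous_on_tendsto_compose[OF cont lim_near[OF that] z] near_cube that by simp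
    then show "(\<lambda>m. f (sc (k m) (y (k m))) i) \<longlonglongrightarrow> f z i"
      by (simp add: tendsto_fun_iff)
    show "(\<lambda>m. sc (k m) (y (k m)) i) \<longlonglongrightarrow> z i"
      using lim_near[OF that] by (simp add: tendsto_fun_iff)
  qed
  have "f z i = z i" for i
  proof (cases "i < n")
    case True
    \<comment> \<open>The limit is taken along vertices labelled 0 for this inequality and along
      vertices labelled 1 for the reverse one.\<close>
    have "z i \<le> f z i"
      using r[OF True] by (intro LIMSEQ_le[OF f_lim(2)[of "r i"] f_lim(1)[of "r i"]])
        (auto intro!: label(4) near_cube True)
    moreover have "f z i \<le> z i"
      using s[OF True] by (intro LIMSEQ_le[OF f_lim(1)[of "s i"] f_lim(2)[of "s i"]])
        (auto intro!: label(5) near_cube True)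
    ultimately show ?thesis by simp
  next
    case False
    moreover have "f z \<in> nat_cube n"
      using z maps by blast
    ultimately show ?thesis
      using z by (simp add: nat_cube_def)
  qed
  with z that show ?thesis by blast
qed

section \<open>Total boundedness\<close>

definition totally_bounded_set :: "'a::metric_space set \<Rightarrow> bool" where
  "totally_bounded_set S \<longleftrightarrow> (\<forall>e>0. \<exists>k. finite k \<and> S \<subseteq> (\<Union>x\<in>k. ball x e))"

text \<open>Each ball of half the radius that meets \<open>S\<close> is recentred at a point of
  \<open>S\<close>. Schauder's argument needs such centres, since their convex combinations must
  stay in the domain.\<close>

lemma totally_bounded_set_centres_in:
  assumes "totally_bounded_set S" "e > 0"
  obtains k where "finite k" "k \<subseteq> S" "S \<subseteq> (\<Union>x\<in>k. ball x e)"
proof -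
  obtain k where k: "finite k" "S \<subseteq> (\<Union>x\<in>k. ball x (e/2))"
    using assms unfolding totally_bounded_set_def by (meson half_gt_zero)
  define k' where "k' = {x \<in> k. ball x (e/2) \<inter> S \<noteq> {}}"
  have "\<forall>x\<in>k'. \<exists>y. y \<in> ball x (e/2) \<inter> S"
    unfolding k'_def by blast
  then obtain c where c: "\<And>x. x \<in> k' \<Longrightarrow> c x \<in> ball x (e/2) \<inter> S"
    by metis
  show ?thesis
  proof
    show "finite (c ` k')" using k(1) by (simp add: k'_def)
    show "c ` k' \<subseteq> S" using c by blast
    show "S \<subseteq> (\<Union>x\<in>c ` k'. ball x e)"
    proof
      fix y assume "y \<in> S"
      then obtain x where "x \<in> k" "y \<in> ball x (e/2)" using k(2) by blast
      with \<open>y \<in> S\<close> have "x \<in> k'" by (auto simp: k'_def)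
      then have "dist (c x) y < e"
        using c[of x] \<open>y \<in> ball x (e/2)\<close> by (metis IntD1 dist_commute dist_triangle_half_l mem_ball)
      with \<open>x \<in> k'\<close> show "y \<in> (\<Union>x\<in>c ` k'. ball x e)" by auto
    qed
  qed
qed

lemma totally_bounded_set_closure:
  assumes "totally_bounded_set S"
  shows "totally_bounded_set (closure S)"
  unfolding totally_bounded_set_def
proof (intro allI impI)
  fix e :: real assume "e > 0"
  then obtain k where k: "finite k" "S \<subseteq> (\<Union>x\<in>k. ball x (e/2))"
    using assms unfolding totally_bounded_set_def by (meson half_gt_zero)
  have "closure S \<subseteq> (\<Union>x\<in>k. cball x (e/2))"
    using k ball_subset_cball by (intro closure_minimal closed_UN) (blast, auto)
  also have "\<dots> \<subseteq> (\<Union>x\<in>k. ball x e)"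
    using \<open>e > 0\<close> by (intro UN_mono) auto
  finally show "\<exists>k. finite k \<and> closure S \<subseteq> (\<Union>x\<in>k. ball x e)"
    using k(1) by blast
qed

lemma totally_bounded_set_imp_compact_closure:
  fixes S :: "'a::complete_space set"
  assumes "totally_bounded_set S"
  shows "compact (closure S)"
  unfolding compact_eq_totally_bounded
  using totally_bounded_set_closure[OF assms]
  by (auto simp: totally_bounded_set_def simp: complete_eq_closed)

section \<open>Schauder's theorem\<close>

text \<open>Schauder projection: \<open>f x\<close> is replaced by a convex combination of those
  points of a finite \<open>e\<close>-net that lie within \<open>e\<close> of it. Brouwer's theorem
  is applied to the coefficients, which range over a cube.\<close>

lemma schauder_approximate:
  fixes f :: "'a::real_normed_vector \<Rightarrow> 'a"
  assumes C: "convex C" "C \<noteq> {}" and cont: "continuous_on C f" and maps: "f \<in> C \<rightarrow> C"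
    and tb: "totally_bounded_set (f ` C)" and e: "e > 0"
  obtains x where "x \<in> C" "norm (f x - x) \<le> e"
proof -
  obtain Y where Y: "finite Y" "Y \<subseteq> f ` C" "f ` C \<subseteq> (\<Union>y\<in>Y. ball y e)"
    using totally_bounded_set_centres_in[OF tb e] by blast
  then obtain y and n :: nat where y: "Y = y ` {i. i < n}"
    by (metis finite_imp_nat_seg_image_inj_on)
  have yC: "y i \<in> C" if "i < n" for i
  proof -
    have "y i \<in> f ` C" using Y(2) y that by blast
    then show ?thesis using maps by (auto simp: Pi_iff)
  qed
  have "n > 0"
    using Y(3) y C(2) by (cases n) auto
  \<comment> \<open>Hat functions centred at the net points and evaluated at \<open>f x\<close>;
    divided by their sum \<open>W x\<close>, they become a partition of unity.\<close>
  define w where "w i x = max 0 (e - norm (f x - y i))" for i x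
  define W where "W x = (\<Sum>i<n. w i x)" for x
  have w_nonneg: "w i x \<ge> 0" for i x by (simp add: w_def)
  have W_pos: "W x > 0" if x: "x \<in> C" for x
  proof -
    obtain i where "i < n" "f x \<in> ball (y i) e"
      using Y(3) y x by blast
    then have "w i x > 0" by (simp add: w_def dist_norm norm_minus_commute)
    then show ?thesis
      unfolding W_def using \<open>i < n\<close> by (intro sum_pos2[of _ i]) (auto simp: w_nonneg)
  qed
  \<comment> \<open>The map \<open>c\<close> retracts the cube onto the simplex \<open>{\<lambda> \<ge> 0, \<Sum>\<lambda> \<le> 1}\<close>; the missing mass goes to \<open>y 0\<close>.\<close>
  define c where "c l i = l i / max 1 (\<Sum>j<n. l j)" for l :: "nat \<Rightarrow> real" and i
  define p where "p l = (\<Sum>i<n. c l i *\<^sub>R y i) + (1 - (\<Sum>i<n. c l i)) *\<^sub>R y 0" for l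
  \<comment> \<open>Sends coefficients to the normalised weights at the point they describe, so a
    fixed point \<open>l\<close> makes \<open>p l\<close> equal to the Schauder projection of
    \<open>f (p l)\<close>.\<close>
  define g where "g l = (\<lambda>i. if i < n then w i (p l) / W (p l) else 0)" for l
  have sum_c: "(\<Sum>i<n. c l i) \<le> 1" for l
    by (simp add: c_def divide_le_eq flip: sum_divide_distrib)
  have p_C: "p l \<in> C" if "l \<in> nat_cube n" for l
  proof -
    \<comment> \<open>A convex combination of \<open>n + 1\<close> points; the extra index
      \<open>n\<close> carries the missing mass at \<open>y 0\<close>.\<close>
    have "p l = (\<Sum>i\<le>n. (if i < n then c l i else 1 - (\<Sum>i<n. c l i)) *\<^sub>R (if i < n then y i else y 0))"
      by (simp add: p_def flip: lessThan_Suc_atMost)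
    also have "\<dots> \<in> C"
      using that sum_c[of l] yC \<open>n > 0\<close>
      by (intro convex_sum C) (auto simp: nat_cube_def c_def simp flip: lessThan_Suc_atMost)
    finally show ?thesis .
  qed
  have coord: "continuous_on (nat_cube n) (\<lambda>l. l i)" for i :: nat
    by (rule continuous_on_subset[OF continuous_on_product_coordinates subset_UNIV])
  have cont_c: "continuous_on (nat_cube n) (\<lambda>l. c l i)" for i
    unfolding c_def
  proof (intro continuous_on_divide continuous_on_max continuous_on_sum continuous_on_const coord ballI)
    show "max 1 (\<Sum>j<n. l j) \<noteq> 0" for l :: "nat \<Rightarrow> real" by linarith
  qed
  have cont_p: "continuous_on (nat_cube n) p"
    unfolding p_def
    by (intro continuous_on_add continuous_on_sum continuous_on_scaleR continuous_on_diff continuous_on_const cont_c)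
  have cont_fp: "continuous_on (nat_cube n) (\<lambda>l. f (p l))"
    using p_C by (intro continuous_on_compose2[OF cont cont_p]) auto
  have cont_w: "continuous_on (nat_cube n) (\<lambda>l. w i (p l))" for i
    unfolding w_def by (intro continuous_on_max continuous_on_norm continuous_on_diff continuous_on_const cont_fp)
  have cont_W: "continuous_on (nat_cube n) (\<lambda>l. W (p l))"
    unfolding W_def by (intro continuous_on_sum cont_w)
  have "continuous_on (nat_cube n) (\<lambda>l. g l i)" for i
  proof (cases "i < n")
    case True
    have "\<forall>l\<in>nat_cube n. W (p l) \<noteq> 0"
      using W_pos p_C by fastforce
    with True show ?thesis
      by (simp add: g_def continuous_on_divide cont_w cont_W)
  qed (simp add: g_def)
  then have "continuous_on (nat_cube n) g"
    by (rule continuous_on_coordinatewise_then_product)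
  moreover have "g \<in> nat_cube n \<rightarrow> nat_cube n"
  proof
    fix l assume "l \<in> nat_cube n"
    then have "W (p l) > 0" using W_pos p_C by blast
    moreover have "w i (p l) \<le> W (p l)" if "i < n" for i
      unfolding W_def using that by (intro member_le_sum) (auto simp: w_nonneg)
    ultimately show "g l \<in> nat_cube n"
      by (auto simp: nat_cube_def g_def w_nonneg divide_le_eq)
  qed
  ultimately obtain l where l: "l \<in> nat_cube n" "g l = l"
    by (rule brouwer_nat_cube)
  define x where "x = p l"
  have xC: "x \<in> C" and Wx: "W x > 0" using p_C l W_pos by (auto simp: x_def)
  have li: "l i = w i x / W x" if "i < n" for i
    using fun_cong[OF l(2), of i] that by (simp add: g_def x_def)
  have "(\<Sum>i<n. l i) = (\<Sum>i<n. w i x) / W x"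
    by (simp add: li sum_divide_distrib)
  \<comment> \<open>At the fixed point the coefficients have total mass 1, so the retraction
    \<open>c\<close> leaves them unchanged and no mass is left for \<open>y 0\<close>.\<close>
  then have sum_l: "(\<Sum>i<n. l i) = 1"
    using Wx by (simp add: W_def)
  then have x_eq: "x = (\<Sum>i<n. l i *\<^sub>R y i)"
    by (simp add: x_def p_def c_def)
  have "(\<Sum>i<n. l i *\<^sub>R (f x - y i)) = (\<Sum>i<n. l i) *\<^sub>R f x - (\<Sum>i<n. l i *\<^sub>R y i)"
    by (simp add: scaleR_diff_right sum_subtractf scaleR_sum_left)
  then have "f x - x = (\<Sum>i<n. l i *\<^sub>R (f x - y i))"
    unfolding sum_l x_eq[symmetric] by simp
  also have "norm \<dots> \<le> (\<Sum>i<n. l i * e)"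
  proof (intro sum_norm_le)
    fix i assume "i \<in> {..<n}"
    then have i: "i < n" by simp
    show "norm (l i *\<^sub>R (f x - y i)) \<le> l i * e"
    \<comment> \<open>A net point at distance at least \<open>e\<close> from \<open>f x\<close> has
      weight 0.\<close>
    proof (cases "norm (f x - y i) < e")
      case True
      moreover have "l i \<ge> 0" using l(1) i by (simp add: nat_cube_def)
      ultimately show ?thesis by (simp add: mult_left_mono)
    next
      case False
      then show ?thesis using li[OF i] by (simp add: w_def)
    qed
  qed
  also have "\<dots> = e" using sum_l by (simp flip: sum_distrib_right)
  finally show ?thesis using that xC by blast
qed

text \<open>Approximate fixed points with errors \<open>1 / (n + 1)\<close> have images in a set
  with compact closure. Along a subsequence the images converge, the points follow them to the same
  limit, and continuity makes that limit fixed.\<close>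

theorem schauder_fixpoint:
  fixes f :: "'a::{real_normed_vector,complete_space} \<Rightarrow> 'a"
  assumes C: "convex C" "closed C" "C \<noteq> {}" and cont: "continuous_on C f" and maps: "f \<in> C \<rightarrow> C"
    and tb: "totally_bounded_set (f ` C)"
  obtains x where "x \<in> C" "f x = x"
proof -
  have "\<exists>x. x \<in> C \<and> norm (f x - x) \<le> inverse (real (Suc n))" for n
    using schauder_approximate[OF C(1,3) cont maps tb, of "inverse (real (Suc n))"] by auto
  then obtain x where x: "\<And>n. x n \<in> C" "\<And>n. norm (f (x n) - x n) \<le> inverse (real (Suc n))"
    by metis
  have "\<forall>n. f (x n) \<in> closure (f ` C)"
    using x(1) closure_subset by blast
  then obtain z k where z: "z \<in> closure (f ` C)" and k: "strict_mono k" and lim: "((\<lambda>n. f (x n)) \<circ> k) \<longlonglongrightarrow> z"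
    using compact_imp_seq_compact[OF totally_bounded_set_imp_compact_closure[OF tb]] by (metis seq_compactE)
  have "closure (f ` C) \<subseteq> C"
    using maps C(2) by (intro closure_minimal) auto
  with z have "z \<in> C" by blast
  have "(\<lambda>n. f (x n) - x n) \<longlonglongrightarrow> 0"
    using x(2) by (intro Lim_null_comparison[OF _ LIMSEQ_inverse_real_of_nat]) auto
  then have "(\<lambda>n. f (x (k n)) - x (k n)) \<longlonglongrightarrow> 0"
    using LIMSEQ_subseq_LIMSEQ[OF _ k] by (fastforce simp: o_def)
  from tendsto_diff[OF lim[unfolded o_def] this] have xk: "(\<lambda>n. x (k n)) \<longlonglongrightarrow> z"
    by simp
  then have "(\<lambda>n. f (x (k n))) \<longlonglongrightarrow> f z"
    using continuous_on_tendsto_compose[OF cont xk \<open>z \<in> C\<close>] x(1) by simp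
  then have "f z = z"
    using lim LIMSEQ_unique by (auto simp: o_def)
  with \<open>z \<in> C\<close> that show ?thesis by blast
qed

section \<open>Periodic mild solutions of the linear equation\<close>

lemma closed_convex_coneD:
  assumes "closed_convex_cone K"
  shows "closed K" "convex K" "0 \<in> K" "\<And>x y. x \<in> K \<Longrightarrow> y \<in> K \<Longrightarrow> x + y \<in> K"
    "\<And>x c. x \<in> K \<Longrightarrow> c \<ge> 0 \<Longrightarrow> c *\<^sub>R x \<in> K"
  using assms convex_cone[of K] cone_contains_0[of K] by (auto simp: closed_convex_cone_def cone_def)

lemma sum_in_closed_convex_cone:
  assumes "closed_convex_cone K" "finite D" "\<And>d. d \<in> D \<Longrightarrow> g d \<in> K"
  shows "sum g D \<in> K"
  using assms(2,3) by (induction D) (auto simp: closed_convex_coneD[OF assms(1)])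

text \<open>Riemann sums are combinations of values of \<open>f\<close> with nonnegative
  coefficients, so they lie in \<open>K\<close>, and \<open>K\<close> is closed.\<close>

lemma has_integral_closed_convex_cone:
  fixes f :: "real \<Rightarrow> 'a::banach"
  assumes K: "closed_convex_cone K" and f: "(f has_integral y) {a..b}" and fK: "\<And>x. x \<in> {a..b} \<Longrightarrow> f x \<in> K"
  shows "y \<in> K"
proof -
  have "\<exists>z\<in>K. dist z y < e" if "e > 0" for e
  proof -
    obtain g where g: "gauge g" "\<forall>D. D tagged_division_of {a..b} \<and> g fine D \<longrightarrow>
        norm ((\<Sum>(x,k)\<in>D. measure lborel k *\<^sub>R f x) - y) < e"
      using has_integral_real[THEN iffD1, rule_format, OF f \<open>e > 0\<close>] by (elim exE conjE)
    obtain D where D: "D tagged_division_of {a..b}" "g fine D"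
      using fine_division_exists_real[OF g(1)] by blast
    have "(\<Sum>(x,k)\<in>D. measure lborel k *\<^sub>R f x) \<in> K"
    proof (rule sum_in_closed_convex_cone[OF K tagged_division_of_finite[OF D(1)]], clarify)
      fix x k assume "(x, k) \<in> D"
      then have "f x \<in> K"
        using tagged_division_ofD(2,3)[OF D(1)] fK by blast
      then show "measure lborel k *\<^sub>R f x \<in> K"
        by (simp add: closed_convex_coneD[OF K])
    qed
    moreover have "dist (\<Sum>(x,k)\<in>D. measure lborel k *\<^sub>R f x) y < e"
      unfolding dist_norm using g(2)[rule_format, OF conjI[OF D]] .
    ultimately show ?thesis by blast
  qed
  then show ?thesis
    using closed_approachable[OF closed_convex_coneD(1)[OF K]] by blast
qed

section \<open>Exponentially stable semigroups and the periodic solution operator\<close>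

text \<open>A decay rate \<open>\<gamma>\<close> replaces the growth exponent, because the infimum
  defining the latter may fail to be attained.\<close>

locale stable_semigroup =
  fixes T :: "real \<Rightarrow> 'a::banach \<Rightarrow>\<^sub>L 'a" and M \<gamma> \<omega> :: real
  assumes semigroup: "C0_semigroup T"
    and \<gamma>_pos: "\<gamma> > 0"
    and \<omega>_pos: "\<omega> > 0"
    and norm_T_le: "\<And>t. t \<ge> 0 \<Longrightarrow> norm (T t) \<le> M * exp (- \<gamma> * t)"
begin

lemma T_0: "T 0 x = x"
  using semigroup by (simp add: C0_semigroup_def)

lemma T_add: "s \<ge> 0 \<Longrightarrow> t \<ge> 0 \<Longrightarrow> T (s + t) x = T s (T t x)"
  using semigroup by (simp add: C0_semigroup_def)

lemma M_nonneg: "M \<ge> 0"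
  using order_trans[OF norm_ge_zero norm_T_le[of 0]] by simp

lemma norm_T_apply_le: "t \<ge> 0 \<Longrightarrow> norm (T t x) \<le> M * norm x * exp (- \<gamma> * t)"
  using norm_blinfun[of "T t" x] mult_right_mono[OF norm_T_le[of t], of "norm x"]
  by (simp add: algebra_simps)

lemma norm_T_apply_le': "t \<ge> 0 \<Longrightarrow> norm (T t x) \<le> M * norm x"
  using norm_T_apply_le[of t x] M_nonneg \<gamma>_pos
  by (smt (verit) exp_le_one_iff mult_left_le mult_nonneg_nonneg norm_ge_zero mult_minus_left)

text \<open>Strong continuity controls a change of time at a fixed vector, and the uniform bound
  \<open>M\<close> controls a change of the vector.\<close>

lemma continuous_on_T_pair: "continuous_on ({0..} \<times> UNIV) (\<lambda>p. T (fst p) (snd p))"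
  unfolding continuous_on_def
proof (intro ballI)
  fix p0 assume p0: "p0 \<in> {0::real..} \<times> (UNIV::'a set)"
  let ?F = "at p0 within {0..} \<times> UNIV"
  have "continuous_on ({0..} \<times> UNIV) (\<lambda>p::real \<times> 'a. T (fst p) (snd p0))"
  proof -
    have "continuous_on {0..} (\<lambda>t. T t (snd p0))"
      using semigroup by (simp add: C0_semigroup_def)
    then show ?thesis
      by (rule continuous_on_compose2[OF _ continuous_on_fst[OF continuous_on_id]]) auto
  qed
  then have "((\<lambda>p. T (fst p) (snd p0)) \<longlongrightarrow> T (fst p0) (snd p0)) ?F"
    using p0 unfolding continuous_on_def by blast
  moreover have "((\<lambda>p. M * norm (snd p - snd p0)) \<longlongrightarrow> 0) ?F"
    by (auto intro!: tendsto_eq_intros)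
  ultimately have "((\<lambda>p. M * norm (snd p - snd p0) + norm (T (fst p) (snd p0) - T (fst p0) (snd p0))) \<longlongrightarrow> 0) ?F"
    by (intro tendsto_add_zero tendsto_norm_zero LIM_zero)
  moreover have "\<forall>\<^sub>F p in ?F. norm (T (fst p) (snd p) - T (fst p0) (snd p0))
      \<le> M * norm (snd p - snd p0) + norm (T (fst p) (snd p0) - T (fst p0) (snd p0))"
  proof (rule eventually_at_topological[THEN iffD2], intro exI[of _ UNIV] conjI ballI impI)
    fix p :: "real \<times> 'a" assume "p \<in> {0..} \<times> (UNIV::'a set)"
    then have "norm (T (fst p) (snd p - snd p0)) \<le> M * norm (snd p - snd p0)"
      by (intro norm_T_apply_le') auto
    moreover have "T (fst p) (snd p) - T (fst p0) (snd p0)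
        = T (fst p) (snd p - snd p0) + (T (fst p) (snd p0) - T (fst p0) (snd p0))"
      by (simp add: blinfun.diff_right)
    ultimately show "norm (T (fst p) (snd p) - T (fst p0) (snd p0))
      \<le> M * norm (snd p - snd p0) + norm (T (fst p) (snd p0) - T (fst p0) (snd p0))"
      by (smt (verit) norm_triangle_ineq)
  qed auto
  ultimately have "((\<lambda>p. T (fst p) (snd p) - T (fst p0) (snd p0)) \<longlongrightarrow> 0) ?F"
    by (rule Lim_null_comparison[rotated])
  then show "((\<lambda>p. T (fst p) (snd p)) \<longlongrightarrow> T (fst p0) (snd p0)) ?F"
    by (rule LIM_zero_cancel)
qed

lemma continuous_on_T:
  fixes A :: "'c::topological_space set"
  assumes "continuous_on A f" "continuous_on A g" "\<And>x. x \<in> A \<Longrightarrow> f x \<ge> 0"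
  shows "continuous_on A (\<lambda>x. T (f x) (g x))"
proof -
  have "continuous_on A (\<lambda>x. (f x, g x))"
    by (intro continuous_on_Pair assms)
  from continuous_on_compose2[OF continuous_on_T_pair this] assms(3) show ?thesis
    by auto
qed

text \<open>\<open>R\<close> is the Neumann series of \<open>(I - T \<omega>)\<^sup>-\<^sup>1\<close>. For \<open>\<omega>\<close>-periodic \<open>f\<close>, \<open>S f\<close> is the
  periodic mild solution of \<open>u' + A u = f\<close>, formally \<open>S f t = \<integral> T (t - s) (f s) ds\<close> over \<open>s \<le> t\<close>.\<close>

definition R :: "'a \<Rightarrow>\<^sub>L 'a" where "R = (\<Sum>n. T (real n * \<omega>))"

lemma summable_norm_T: "summable (\<lambda>n. norm (T (real n * \<omega>)))"
proof (rule summable_comparison_test')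
  show "summable (\<lambda>n. M * exp (- \<gamma> * \<omega>) ^ n)"
    using \<gamma>_pos \<omega>_pos by (intro summable_mult summable_geometric) simp
  show "norm (norm (T (real n * \<omega>))) \<le> M * exp (- \<gamma> * \<omega>) ^ n" if "n \<ge> 0" for n
    using norm_T_le[of "real n * \<omega>"] \<omega>_pos
    by (simp flip: exp_of_nat_mult add: algebra_simps)
qed

lemma R_sums: "(\<lambda>n. T (real n * \<omega>) x) sums R x"
  unfolding R_def
  using bounded_linear.sums[OF blinfun.bounded_linear_left summable_sums[OF summable_norm_cancel[OF summable_norm_T]]] .

text \<open>Split off the term \<open>n = 0\<close> of the Neumann series and factor
  \<open>T \<omega>\<close> out of the tail, on the left for the first identity and on the right for
  the second.\<close>

lemma R_eq: "R x = x + T \<omega> (R x)" and R_eq': "R x = x + R (T \<omega> x)"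
proof -
  have tail: "(\<lambda>n. T (real (Suc n) * \<omega>) x) sums (R x - x)"
    using R_sums[of x] by (subst sums_Suc_iff) (simp add: T_0)
  have "T (real (Suc n) * \<omega>) x = T \<omega> (T (real n * \<omega>) x)" for n
    using T_add[of \<omega> "real n * \<omega>" x] \<omega>_pos by (simp add: algebra_simps)
  moreover have "(\<lambda>n. T \<omega> (T (real n * \<omega>) x)) sums T \<omega> (R x)"
    by (rule bounded_linear.sums[OF blinfun.bounded_linear_right R_sums])
  ultimately have "T \<omega> (R x) = R x - x"
    using tail sums_unique2 by simp
  then show "R x = x + T \<omega> (R x)" by simp
  have "T (real (Suc n) * \<omega>) x = T (real n * \<omega>) (T \<omega> x)" for n
    using T_add[of "real n * \<omega>" \<omega> x] \<omega>_pos by (simp add: algebra_simps)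
  then have "R (T \<omega> x) = R x - x"
    using tail R_sums[of "T \<omega> x"] sums_unique2 by simp
  then show "R x = x + R (T \<omega> x)" by simp
qed

text \<open>For such \<open>x\<close>, \<open>R_eq'\<close> reads \<open>R x = x + R x\<close>. This
  is the uniqueness on which \<open>S_mild\<close> rests.\<close>

lemma T_fixpoint_zero: "T \<omega> x = x \<Longrightarrow> x = 0"
  using R_eq'[of x] by simp

definition S :: "(real \<Rightarrow> 'a) \<Rightarrow> real \<Rightarrow> 'a" where
  "S f t = R (integral {0..\<omega>} (\<lambda>r. T r (f (t - r))))"

context
  fixes f :: "real \<Rightarrow> 'a"
  assumes f: "continuous_on UNIV f"
begin

lemma continuous_on_compose_UNIV: "continuous_on A g \<Longrightarrow> continuous_on A (\<lambda>x. f (g x))"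
  by (rule continuous_on_compose2[OF f]) auto

lemma integrable_T: "c \<ge> 0 \<Longrightarrow> (\<lambda>r. T (c + r) (f (t - r))) integrable_on {0..b}"
  by (intro integrable_continuous_interval continuous_on_T continuous_on_compose_UNIV continuous_intros) auto

lemma integrable_T_mild: "b \<le> t \<Longrightarrow> (\<lambda>s. T (t - s) (f s)) integrable_on {a..b}"
  by (intro integrable_continuous_interval continuous_on_T continuous_on_compose_UNIV continuous_intros) auto

lemma S_continuous: "continuous_on UNIV (S f)"
proof -
  have "continuous_on (UNIV \<times> cbox 0 \<omega>) (\<lambda>p. T (snd p) (f (fst p - snd p)))"
    by (intro continuous_on_T continuous_on_compose_UNIV continuous_intros) auto
  then have "continuous_on UNIV (\<lambda>t. integral (cbox 0 \<omega>) (\<lambda>r. T r (f (t - r))))"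
    by (intro integral_continuous_on_param) (simp add: case_prod_unfold)
  then show ?thesis
    unfolding S_def[abs_def] by (intro continuous_intros) simp
qed

text \<open>The norm bound \<open>1 / \<gamma>\<close> for \<open>S\<close> in the equivalent norm,
  written out without introducing that norm. The constant \<open>M\<close> does not enter, which is
  what makes the condition \<open>c1 + c2 < \<gamma>\<close> sufficient for a contraction.\<close>

lemma T_S_bound:
  assumes b: "\<And>s r. r \<ge> 0 \<Longrightarrow> norm (T r (f s)) \<le> P * exp (- \<gamma> * r)" and r: "r \<ge> 0"
  shows "norm (T r (S f t)) \<le> P / \<gamma> * exp (- \<gamma> * r)"
proof -
  define J where "J = integral {0..\<omega>} (\<lambda>r. T r (f (t - r)))"
  define q where "q = exp (- \<gamma> * \<omega>)"
  have q: "0 < q" "q < 1" using \<gamma>_pos \<omega>_pos by (auto simp: q_def)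
  \<comment> \<open>Integrating the exponential over a single period leaves the factor
    \<open>1 - q\<close>, which the geometric sum over the Neumann series cancels below.\<close>
  have TJ: "norm (T c J) \<le> P / \<gamma> * exp (- \<gamma> * c) * (1 - q)" if c: "c \<ge> 0" for c
  proof -
    have "((\<lambda>x. P * exp (- \<gamma> * (c + x))) has_integral
        (- P / \<gamma> * exp (- \<gamma> * (c + \<omega>)) - (- P / \<gamma> * exp (- \<gamma> * (c + 0))))) {0..\<omega>}"
      using \<gamma>_pos \<omega>_pos
      by (intro fundamental_theorem_of_calculus)
        (auto intro!: derivative_eq_intros simp flip: has_real_derivative_iff_has_vector_derivative)
    also have "(- P / \<gamma> * exp (- \<gamma> * (c + \<omega>)) - (- P / \<gamma> * exp (- \<gamma> * (c + 0)))) = P / \<gamma> * exp (- \<gamma> * c) * (1 - q)"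
    proof -
      have "exp (- \<gamma> * (c + \<omega>)) = exp (- \<gamma> * c) * q"
        by (simp add: q_def algebra_simps flip: exp_add)
      then show ?thesis by (simp add: algebra_simps diff_divide_distrib)
    qed
    finally have I: "((\<lambda>x. P * exp (- \<gamma> * (c + x))) has_integral P / \<gamma> * exp (- \<gamma> * c) * (1 - q)) {0..\<omega>}" .
    have "(\<lambda>r. T r (f (t - r))) integrable_on {0..\<omega>}"
      using integrable_T[of 0 t \<omega>] by simp
    then have "T c J = integral {0..\<omega>} (\<lambda>r. T c (T r (f (t - r))))"
      unfolding J_def using integral_linear[OF _ blinfun.bounded_linear_right, of "\<lambda>r. T r (f (t - r))" "{0..\<omega>}" "T c"]
      by (simp add: o_def)
    also have "\<dots> = integral {0..\<omega>} (\<lambda>r. T (c + r) (f (t - r)))"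
      by (rule integral_cong) (use c in \<open>simp add: T_add\<close>)
    also have "norm \<dots> \<le> integral {0..\<omega>} (\<lambda>x. P * exp (- \<gamma> * (c + x)))"
      using c by (intro Henstock_Kurzweil_Integration.integral_norm_bound_integral integrable_T
          has_integral_integrable[OF I] b) auto
    finally show ?thesis
      using integral_unique[OF I] by simp
  qed
  have 1: "(\<lambda>n. T r (T (real n * \<omega>) J)) sums T r (S f t)"
    unfolding S_def J_def by (rule bounded_linear.sums[OF blinfun.bounded_linear_right R_sums])
  have 2: "norm (T r (T (real n * \<omega>) J)) \<le> P / \<gamma> * exp (- \<gamma> * r) * (1 - q) * q ^ n" for n
  proof -
    have "exp (- \<gamma> * (r + real n * \<omega>)) = exp (- \<gamma> * r) * q ^ n"
      by (simp add: q_def algebra_simps flip: exp_of_nat_mult exp_add)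
    then show ?thesis
      using TJ[of "r + real n * \<omega>"] r \<omega>_pos by (simp add: T_add algebra_simps)
  qed
  have 3: "(\<lambda>n. P / \<gamma> * exp (- \<gamma> * r) * (1 - q) * q ^ n) sums (P / \<gamma> * exp (- \<gamma> * r))"
    using sums_mult[OF geometric_sums[of q], of "P / \<gamma> * exp (- \<gamma> * r) * (1 - q)"] q by simp
  show ?thesis
    by (rule norm_sums_le[OF 1 3 2])
qed

lemma S_bound: "(\<And>s. norm (f s) \<le> B) \<Longrightarrow> norm (S f t) \<le> M * B / \<gamma>"
proof -
  assume B: "\<And>s. norm (f s) \<le> B"
  have "norm (T r (f s)) \<le> M * B * exp (- \<gamma> * r)" if "r \<ge> 0" for r s
    using norm_T_apply_le[OF that, of "f s"] B[of s] M_nonneg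
    by (smt (verit) exp_ge_zero mult_left_mono mult_right_mono)
  from T_S_bound[OF this, of 0 t] show ?thesis by (simp add: T_0)
qed

text \<open>The integral over one period lies in \<open>K\<close>, hence so do the partial sums of
  the Neumann series, and their limit because \<open>K\<close> is closed.\<close>

lemma S_in_cone:
  assumes "closed_convex_cone K" "positive_semigroup T K" "\<And>s. f s \<in> K"
  shows "S f t \<in> K"
proof -
  note K = closed_convex_coneD[OF assms(1)]
  have T_K: "T r x \<in> K" if "r \<ge> 0" "x \<in> K" for r x
    using assms(2) that unfolding positive_semigroup_def by blast
  have "integral {0..\<omega>} (\<lambda>r. T r (f (t - r))) \<in> K" (is "?J \<in> K")
    using integrable_T[of 0 t \<omega>]
    by (intro has_integral_closed_convex_cone[OF assms(1) integrable_integral]) (auto intro!: T_K assms(3))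
  then have "(\<Sum>i<n. T (real i * \<omega>) ?J) \<in> K" for n
    using \<omega>_pos by (induction n) (auto intro!: K T_K)
  with R_sums[of ?J, unfolded sums_def] show ?thesis
    unfolding S_def by (rule closed_sequentially[OF K(1), rotated])
qed

text \<open>The difference between the claimed value and the integral turns out to be fixed by
  \<open>T \<omega>\<close>, so it vanishes by \<open>T_fixpoint_zero\<close>.\<close>

lemma S_mild:
  assumes per: "\<And>s. f (s + \<omega>) = f s" and at: "a \<le> t"
  shows "((\<lambda>s. T (t - s) (f s)) has_integral (S f t - T (t - a) (S f a))) {a..t}"
proof -
  define J where "J t = integral {0..\<omega>} (\<lambda>r. T r (f (t - r)))" for t
  \<comment> \<open>Substitution \<open>s = t - r\<close>.\<close>
  have J: "((\<lambda>s. T (t - s) (f s)) has_integral J t) {t - \<omega>..t}" for t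
  proof -
    have "((\<lambda>r. T r (f (t - r))) has_integral J t) (cbox 0 \<omega>)"
      unfolding J_def using integrable_integral[OF integrable_T[of 0 t \<omega>]] by simp
    from has_integral_affinity[OF this, of "-1" t] show ?thesis
      by (simp add: image_affinity_atLeastAtMost)
  qed
  \<comment> \<open>The kernel keeps the end time \<open>t\<close> while the limits of integration
    vary, so that pieces can be added.\<close>
  define I where "I b c = integral {b..c} (\<lambda>s. T (t - s) (f s))" for b c
  have combine: "I b c + I c d = I b d" if "b \<le> c" "c \<le> d" "d \<le> t" for b c d
    unfolding I_def using that by (intro Henstock_Kurzweil_Integration.integral_combine integrable_T_mild)
  have T_int: "T c (integral {b..d} (\<lambda>s. T (e - s) (f s))) = integral {b..d} (\<lambda>s. T (c + e - s) (f s))"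
    if "c \<ge> 0" "d \<le> e" for b c d e
  proof -
    have "T c (integral {b..d} (\<lambda>s. T (e - s) (f s))) = integral {b..d} (\<lambda>s. T c (T (e - s) (f s)))"
      using integral_linear[OF integrable_T_mild[OF that(2)] blinfun.bounded_linear_right, of b "T c"]
      by (simp add: o_def)
    also have "\<dots> = integral {b..d} (\<lambda>s. T (c + e - s) (f s))"
      using that by (intro integral_cong) (simp add: algebra_simps flip: T_add)
    finally show ?thesis .
  qed
  have Jt: "J t = I (t - \<omega>) t"
    unfolding I_def using integral_unique[OF J] by simp
  have Ja: "T (t - a) (J a) = I (a - \<omega>) a"
    using T_int[of "t - a" a a "a - \<omega>"] integral_unique[OF J[of a]] at by (simp add: I_def)
  \<comment> \<open>Applying \<open>T \<omega>\<close> lengthens the time lag by one period;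
    periodicity of \<open>f\<close> turns this into a shift of the interval.\<close>
  have TI: "T \<omega> (I a t) = I (a - \<omega>) (t - \<omega>)"
  proof -
    have "T \<omega> (I a t) = integral {a..t} (\<lambda>s. T (\<omega> + t - s) (f s))"
      unfolding I_def using \<omega>_pos by (intro T_int) auto
    also have "\<dots> = integral {a..t} ((\<lambda>s. T (t - s) (f s)) \<circ> (+) (- \<omega>))"
      using per[of "_ - \<omega>"] by (intro integral_cong) (simp add: algebra_simps)
    also have "\<dots> = I (a - \<omega>) (t - \<omega>)"
      unfolding I_def by (subst integral_shift_Icc_real) simp
    finally show ?thesis .
  qed
  have S_eq: "S f t = J t + T \<omega> (S f t)" for t
    unfolding S_def J_def by (rule R_eq)
  define D where "D = S f t - T (t - a) (S f a)"
  have comm: "T (t - a) (T \<omega> x) = T \<omega> (T (t - a) x)" for x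
    using at \<omega>_pos by (simp add: add.commute flip: T_add)
  have "D = J t + T \<omega> (S f t) - T (t - a) (J a + T \<omega> (S f a))"
    using S_eq[of t] S_eq[of a] by (simp add: D_def)
  also have "\<dots> = J t - T (t - a) (J a) + T \<omega> D"
    by (simp add: D_def blinfun.add_right blinfun.diff_right comm)
  \<comment> \<open>The interval from \<open>a - \<omega>\<close> to \<open>t\<close> is split at
    \<open>t - \<omega>\<close> and at \<open>a\<close>; comparing the two splittings works whether
    or not \<open>t - a\<close> exceeds \<open>\<omega>\<close>.\<close>
  also have "J t - T (t - a) (J a) = I a t - I (a - \<omega>) (t - \<omega>)"
    using combine[of "a - \<omega>" "t - \<omega>" t] combine[of "a - \<omega>" a t] at \<omega>_pos
    by (simp add: Jt Ja algebra_simps)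
  finally have "T \<omega> (D - I a t) = D - I a t"
    by (simp only: blinfun.diff_right TI) (simp add: algebra_simps)
  then have "I a t = D"
    using T_fixpoint_zero[of "D - I a t"] by simp
  then show ?thesis
    using integrable_integral[OF integrable_T_mild[of t t a]] by (simp add: I_def D_def)
qed

end

lemma S_periodic: "(\<And>s. f (s + \<omega>) = f s) \<Longrightarrow> S f (t + \<omega>) = S f t"
proof -
  assume f: "\<And>s. f (s + \<omega>) = f s"
  have "f (t + \<omega> - r) = f (t - r)" for r
    using f[of "t - r"] by (simp add: algebra_simps)
  then show ?thesis by (simp add: S_def)
qed

lemma S_diff:
  assumes f: "continuous_on UNIV f" and g: "continuous_on UNIV g"
  shows "S (\<lambda>s. f s - g s) t = S f t - S g t"
  using integrable_T[OF f, of 0 t \<omega>] integrable_T[OF g, of 0 t \<omega>]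
  by (simp add: S_def blinfun.diff_right Henstock_Kurzweil_Integration.integral_diff)

end

section \<open>Periodic functions\<close>

lemma periodic_int_multiple:
  fixes f :: "real \<Rightarrow> 'a"
  assumes "\<And>t. f (t + \<omega>) = f t"
  shows "f (t + real_of_int k * \<omega>) = f t"
proof (induction k arbitrary: t rule: int_induct[where k = 0])
  case (step1 i)
  then show ?case using assms[of "t + real_of_int i * \<omega>"] by (simp add: algebra_simps)
next
  case (step2 i)
  then show ?case using assms[of "t + real_of_int (i - 1) * \<omega>"] by (simp add: algebra_simps)
qed simp

lemma reduce_to_period:
  fixes t \<omega> :: real
  assumes "\<omega> > 0"
  obtains s k where "s \<in> {0..\<omega>}" "t = s + real_of_int k * \<omega>"
proof
  have "of_int \<lfloor>t / \<omega>\<rfloor> * \<omega> \<le> t / \<omega> * \<omega>" "t / \<omega> * \<omega> \<le> (of_int \<lfloor>t / \<omega>\<rfloor> + 1) * \<omega>"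
    using assms by (intro mult_right_mono; linarith)+
  then show "t - real_of_int \<lfloor>t / \<omega>\<rfloor> * \<omega> \<in> {0..\<omega>}"
    using assms by (simp add: algebra_simps)
  show "t = t - real_of_int \<lfloor>t / \<omega>\<rfloor> * \<omega> + real_of_int \<lfloor>t / \<omega>\<rfloor> * \<omega>"
    by simp
qed

lemma periodic_bounded:
  fixes f :: "real \<Rightarrow> 'a::real_normed_vector"
  assumes "\<omega> > 0" "continuous_on UNIV f" "\<And>t. f (t + \<omega>) = f t"
  obtains B where "\<And>t. norm (f t) \<le> B"
proof -
  have "compact (f ` {0..\<omega>})"
    using assms(2) continuous_on_subset by (intro compact_continuous_image) auto
  then obtain B where B: "\<And>s. s \<in> {0..\<omega>} \<Longrightarrow> norm (f s) \<le> B"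
    by (meson bounded_iff compact_imp_bounded imageI)
  have "norm (f t) \<le> B" for t
  proof -
    obtain s k where "s \<in> {0..\<omega>}" "t = s + real_of_int k * \<omega>"
      using reduce_to_period[OF assms(1)] .
    then show ?thesis
      using B periodic_int_multiple[of f, OF assms(3)] by simp
  qed
  with that show ?thesis by blast
qed

section \<open>The linear majorant\<close>

context stable_semigroup begin

text \<open>Picard iteration from 0. In the equivalent norm the increments shrink by the factor
  \<open>(c1 + c2) / \<gamma> < 1\<close>; the delay does no harm because the bounds are uniform in
  time. Every iterate is periodic and in \<open>K\<close>, and both properties pass to the
  limit.\<close>

lemma linear_delay_solution:
  assumes K: "closed_convex_cone K" and pos: "positive_semigroup T K"
    and c: "c1 \<ge> 0" "c2 \<ge> 0" "c1 + c2 < \<gamma>"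
    and h: "continuous_on UNIV h" "\<And>t. h (t + \<omega>) = h t" "\<And>t. h t \<in> K"
  obtains v where "continuous_on UNIV v" "\<And>t. v (t + \<omega>) = v t" "\<And>t. v t \<in> K"
    "\<And>t. v t = S (\<lambda>s. c1 *\<^sub>R v s + c2 *\<^sub>R v (s - \<tau>) + h s) t"
proof -
  note Kd = closed_convex_coneD[OF K]
  define G where "G u = (\<lambda>s. c1 *\<^sub>R u s + c2 *\<^sub>R u (s - \<tau>) + h s)" for u
  have G_cont: "continuous_on UNIV (G u)" if "continuous_on UNIV u" for u
    unfolding G_def by (intro continuous_intros h that continuous_on_compose2[OF that]) auto
  have G_per: "G u (t + \<omega>) = G u t" if "\<And>t. u (t + \<omega>) = u t" for u t
    using that[of t] that[of "t - \<tau>"] h(2)[of t] by (simp add: G_def algebra_simps)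
  define V where "V n = ((\<lambda>u. S (G u)) ^^ n) (\<lambda>_. 0)" for n
  have V_Suc: "V (Suc n) = S (G (V n))" for n
    by (simp add: V_def)
  have V_0: "V 0 = (\<lambda>_. 0)"
    by (simp add: V_def)
  have V_cont: "continuous_on UNIV (V n)" for n
    by (induction n) (auto simp: V_0 V_Suc intro!: S_continuous G_cont)
  have V_per: "V n (t + \<omega>) = V n t" for n t
    by (induction n arbitrary: t) (auto simp: V_0 V_Suc intro!: S_periodic G_per)
  have V_K: "V n t \<in> K" for n t
  proof (induction n arbitrary: t)
    case (Suc n)
    then have "G (V n) s \<in> K" for s
      unfolding G_def using c h(3) by (intro Kd)
    then show ?case
      unfolding V_Suc by (rule S_in_cone[OF G_cont[OF V_cont] K pos])
  qed (simp add: V_0 Kd)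
  obtain B where B: "\<And>t. norm (h t) \<le> B"
    using periodic_bounded[OF \<omega>_pos h(1,2)] by blast
  define P where "P = M * B / \<gamma>"
  define q where "q = (c1 + c2) / \<gamma>"
  have q: "0 \<le> q" "q < 1" using c \<gamma>_pos by (auto simp: q_def)
  have S_G_diff: "S (G u) t - S (G w) t = S (\<lambda>s. c1 *\<^sub>R (u s - w s) + c2 *\<^sub>R (u (s - \<tau>) - w (s - \<tau>))) t"
    if "continuous_on UNIV u" "continuous_on UNIV w" for u w t
  proof -
    have "S (G u) t - S (G w) t = S (\<lambda>s. G u s - G w s) t"
      by (simp add: S_diff G_cont that)
    also have "(\<lambda>s. G u s - G w s) = (\<lambda>s. c1 *\<^sub>R (u s - w s) + c2 *\<^sub>R (u (s - \<tau>) - w (s - \<tau>)))"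
      by (simp add: G_def algebra_simps)
    finally show ?thesis .
  qed
  have delay_cont: "continuous_on UNIV (\<lambda>s. c1 *\<^sub>R (u s - w s) + c2 *\<^sub>R (u (s - \<tau>) - w (s - \<tau>)))"
    if "continuous_on UNIV u" "continuous_on UNIV w" for u w :: "real \<Rightarrow> 'a"
    by (intro continuous_intros that continuous_on_compose2[OF that(1)] continuous_on_compose2[OF that(2)]) auto
  \<comment> \<open>The induction carries the bound for all \<open>T r\<close> and not only for
    \<open>r = 0\<close>: plain norms and \<open>S_bound\<close> would give the factor
    \<open>M * (c1 + c2) / \<gamma>\<close>, which may exceed 1.\<close>
  have T_diff: "norm (T r (V (Suc n) t - V n t)) \<le> P * q ^ n * exp (- \<gamma> * r)" if "r \<ge> 0" for n t r
    using that
  proof (induction n arbitrary: t r)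
    case 0
    have "norm (T r (h s)) \<le> M * B * exp (- \<gamma> * r)" if "r \<ge> 0" for r s
      using norm_T_apply_le[OF that, of "h s"] B[of s] M_nonneg
      by (smt (verit) exp_ge_zero mult_left_mono mult_right_mono)
    from T_S_bound[OF h(1) this 0] show ?case
      by (simp add: V_Suc V_0 P_def G_def)
  next
    case (Suc n)
    let ?d = "\<lambda>s. V (Suc n) s - V n s"
    have b: "norm (T r (c1 *\<^sub>R ?d s + c2 *\<^sub>R ?d (s - \<tau>))) \<le> (c1 + c2) * P * q ^ n * exp (- \<gamma> * r)"
      if "r \<ge> 0" for r s
    proof -
      have "norm (T r (c1 *\<^sub>R ?d s + c2 *\<^sub>R ?d (s - \<tau>))) \<le> c1 * norm (T r (?d s)) + c2 * norm (T r (?d (s - \<tau>)))"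
        using norm_triangle_ineq[of "c1 *\<^sub>R T r (?d s)" "c2 *\<^sub>R T r (?d (s - \<tau>))"] c
        by (simp add: blinfun.add_right blinfun.scaleR_right)
      also have "\<dots> \<le> c1 * (P * q ^ n * exp (- \<gamma> * r)) + c2 * (P * q ^ n * exp (- \<gamma> * r))"
        by (intro add_mono mult_left_mono Suc.IH that c)
      finally show ?thesis by (simp add: algebra_simps)
    qed
    have "V (Suc (Suc n)) t - V (Suc n) t = S (\<lambda>s. c1 *\<^sub>R ?d s + c2 *\<^sub>R ?d (s - \<tau>)) t"
      unfolding V_Suc[of "Suc n"] V_Suc[of n] using S_G_diff[OF V_cont V_cont, of "Suc n" t n]
      by (simp add: V_Suc)
    then show ?case
      using T_S_bound[OF delay_cont[OF V_cont V_cont] b Suc.prems, of t]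
      by (simp add: q_def mult.commute mult.left_commute)
  qed
  have "uniform_limit UNIV (\<lambda>n t. \<Sum>i<n. V (Suc i) t - V i t) (\<lambda>t. \<Sum>i. V (Suc i) t - V i t) sequentially"
  proof (rule Weierstrass_m_test)
    show "norm (V (Suc n) t - V n t) \<le> P * q ^ n" for n t
      using T_diff[of 0 n t] by (simp add: T_0)
    show "summable (\<lambda>n. P * q ^ n)"
      using q by (intro summable_mult summable_geometric) auto
  qed
  then obtain v where "uniform_limit UNIV (\<lambda>n t. \<Sum>i<n. V (Suc i) t - V i t) v sequentially"
    by blast
  \<comment> \<open>The partial sums telescope to \<open>V n\<close>, since the iteration starts at
    0.\<close>
  moreover have "(\<lambda>n t. \<Sum>i<n. V (Suc i) t - V i t) = V"
    using sum_lessThan_telescope[of "\<lambda>i. V i t" n for n t] by (simp add: fun_eq_iff V_0)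
  ultimately have lim: "uniform_limit UNIV V v sequentially"
    by simp
  have lim_t: "(\<lambda>n. V n t) \<longlonglongrightarrow> v t" for t
    using tendsto_uniform_limitI[OF lim] by simp
  have v_cont: "continuous_on UNIV v"
    using uniform_limit_theorem[OF _ lim] V_cont by simp
  show ?thesis
  proof
    show "continuous_on UNIV v" by (rule v_cont)
    show "v (t + \<omega>) = v t" for t
      using LIMSEQ_unique[OF lim_t[of "t + \<omega>"]] lim_t[of t] V_per by simp
    show "v t \<in> K" for t
      using closed_sequentially[OF Kd(1) V_K lim_t] .
    show "v t = S (\<lambda>s. c1 *\<^sub>R v s + c2 *\<^sub>R v (s - \<tau>) + h s) t" for t
    proof -
      \<comment> \<open>A Lipschitz constant of the iteration in the sup norm. Only continuity is
        wanted here, so \<open>L\<close> may be large.\<close>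
      define L where "L = M * (c1 + c2) / \<gamma>"
      have L: "L \<ge> 0" using M_nonneg c \<gamma>_pos by (simp add: L_def)
      have "(\<lambda>n. V (Suc n) t) \<longlonglongrightarrow> S (G v) t"
      proof (rule LIMSEQ_I)
        fix e :: real assume "e > 0"
        define e' where "e' = e / (L + 1)"
        have "e' > 0" using \<open>e > 0\<close> L by (simp add: e'_def)
        then obtain N where N: "\<And>n s. n \<ge> N \<Longrightarrow> dist (V n s) (v s) < e'"
          using lim unfolding uniform_limit_sequentially_iff by blast
        have "norm (V (Suc n) t - S (G v) t) < e" if "n \<ge> N" for n
        proof -
          have "norm (c1 *\<^sub>R (V n s - v s) + c2 *\<^sub>R (V n (s - \<tau>) - v (s - \<tau>))) \<le> (c1 + c2) * e'" for s
          proof -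
            have "norm (c1 *\<^sub>R (V n s - v s) + c2 *\<^sub>R (V n (s - \<tau>) - v (s - \<tau>)))
                \<le> c1 * norm (V n s - v s) + c2 * norm (V n (s - \<tau>) - v (s - \<tau>))"
              using norm_triangle_ineq[of "c1 *\<^sub>R (V n s - v s)" "c2 *\<^sub>R (V n (s - \<tau>) - v (s - \<tau>))"] c by simp
            also have "\<dots> \<le> c1 * e' + c2 * e'"
              using N[OF that, of s] N[OF that, of "s - \<tau>"] c
              by (intro add_mono mult_left_mono) (auto simp: dist_norm)
            finally show ?thesis by (simp add: algebra_simps)
          qed
          then have "norm (V (Suc n) t - S (G v) t) \<le> M * ((c1 + c2) * e') / \<gamma>"
            unfolding V_Suc S_G_diff[OF V_cont v_cont]
            by (rule S_bound[OF delay_cont[OF V_cont v_cont]])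
          also have "\<dots> = L * e'" by (simp add: L_def)
          also have "\<dots> < e"
            using \<open>e > 0\<close> L by (simp add: e'_def field_simps)
          finally show ?thesis .
        qed
        then show "\<exists>N. \<forall>n\<ge>N. norm (V (Suc n) t - S (G v) t) < e" by blast
      qed
      then have "(\<lambda>n. V n t) \<longlonglongrightarrow> S (G v) t"
        by (rule LIMSEQ_imp_Suc)
      with lim_t have "v t = S (G v) t"
        by (rule LIMSEQ_unique)
      then show ?thesis by (simp add: G_def)
    qed
  qed
qed

section \<open>Compactness of the solution operator\<close>

text \<open>By \<open>S_mild\<close> the left side is the norm of an integral over
  \<open>{a..t}\<close>. It is applied on short intervals, to compare \<open>S f t\<close> with an
  image under the semigroup.\<close>

lemma mild_integral_bound:
  assumes f: "continuous_on UNIV f" "\<And>s. f (s + \<omega>) = f s" "\<And>s. norm (f s) \<le> B" and "a \<le> t"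
  shows "norm (S f t - T (t - a) (S f a)) \<le> M * B * (t - a)"
proof -
  have "norm (T (t - s) (f s)) \<le> M * B" if "s \<in> {a..t}" for s
    using norm_T_apply_le'[of "t - s" "f s"] mult_left_mono[OF f(3) M_nonneg, of s] that by simp
  moreover have "0 \<le> M * B"
    using M_nonneg order_trans[OF norm_ge_zero f(3)] by simp
  ultimately show ?thesis
    using has_integral_bound_real[OF _ finite.emptyI S_mild[OF f(1,2) \<open>a \<le> t\<close>], of "M * B"] \<open>a \<le> t\<close> by simp
qed

context
  fixes \<G> :: "(real \<Rightarrow> 'a) set" and B :: real
  assumes cpt: "compact_semigroup T"
    and \<G>: "\<G> \<subseteq> {f. continuous_on UNIV f \<and> (\<forall>s. f (s + \<omega>) = f s) \<and> (\<forall>s. norm (f s) \<le> B)}"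
    and B_nonneg: "B \<ge> 0"
begin

lemma bounded_familyD:
  assumes "f \<in> \<G>"
  shows "continuous_on UNIV f" "f (s + \<omega>) = f s" "norm (f s) \<le> B"
  using assms \<G> by auto

text \<open>\<open>S f t\<close> is within \<open>M * B * \<delta>\<close> of
  \<open>T \<delta> (S f (t - \<delta>))\<close>, which lies in the image of a fixed ball under the
  compact operator \<open>T \<delta>\<close>.\<close>

lemma totally_bounded_S_values: "totally_bounded_set {S f t |f t. f \<in> \<G>}"
  unfolding totally_bounded_set_def
proof (intro allI impI)
  fix e :: real assume e: "e > 0"
  \<comment> \<open>Makes \<open>M * B * \<delta>\<close> less than \<open>e / 2\<close>; the added
    1 covers \<open>M * B = 0\<close>.\<close>
  define \<delta> where "\<delta> = e / (2 * (M * B + 1))"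
  have MB: "M * B \<ge> 0" using M_nonneg B_nonneg by simp
  then have \<delta>: "\<delta> > 0" "M * B * \<delta> < e / 2"
    using e by (auto simp: \<delta>_def field_simps add_pos_nonneg)
  have "compact (closure (T \<delta> ` cball 0 (M * B / \<gamma>)))"
    using cpt \<delta>(1) bounded_cball unfolding compact_semigroup_def compact_operator_def by blast
  then obtain k where k: "finite k" "closure (T \<delta> ` cball 0 (M * B / \<gamma>)) \<subseteq> (\<Union>x\<in>k. ball x (e/2))"
    unfolding compact_eq_totally_bounded using e by (meson half_gt_zero)
  have "S f t \<in> (\<Union>x\<in>k. ball x e)" if f: "f \<in> \<G>" for f t
  proof -
    have "S f (t - \<delta>) \<in> cball 0 (M * B / \<gamma>)"
      using S_bound[OF bounded_familyD(1)[OF f] bounded_familyD(3)[OF f]] by simp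
    then have "T \<delta> (S f (t - \<delta>)) \<in> (\<Union>x\<in>k. ball x (e/2))"
      by (intro subsetD[OF k(2)] subsetD[OF closure_subset] imageI)
    then obtain x where x: "x \<in> k" "dist x (T \<delta> (S f (t - \<delta>))) < e/2"
      by auto
    have "dist (T \<delta> (S f (t - \<delta>))) (S f t) < e/2"
      using mild_integral_bound[OF bounded_familyD(1)[OF f] bounded_familyD(2)[OF f] bounded_familyD(3)[OF f], of "t - \<delta>" t] \<delta>
      by (simp add: dist_norm norm_minus_commute)
    with x show ?thesis
      by (metis UN_iff dist_commute dist_triangle_half_l mem_ball)
  qed
  then show "\<exists>k. finite k \<and> {S f t |f t. f \<in> \<G>} \<subseteq> (\<Union>x\<in>k. ball x e)"
    using k(1) by blast
qed

text \<open>Strong continuity at \<open>0\<close> is uniform on totally bounded sets, so the compactness of the values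
  gives equicontinuity.\<close>

lemma equicontinuous_S:
  assumes e: "e > 0"
  obtains d where "d > 0" "\<And>f s t. f \<in> \<G> \<Longrightarrow> \<bar>s - t\<bar> < d \<Longrightarrow> dist (S f s) (S f t) < e"
proof -
  \<comment> \<open>Replacing \<open>S f s\<close> by a nearby net point costs \<open>M * e'\<close>
    under the semigroup and \<open>e'\<close> outside it, \<open>e / 4\<close> together. Moving the
    net point costs another \<open>e / 4\<close>, and the integral term has \<open>e / 2\<close>
    left.\<close>
  define e' where "e' = e / (4 * (M + 1))"
  have e': "e' > 0" "(M + 1) * e' = e / 4"
    using e M_nonneg by (auto simp: e'_def field_simps add_pos_nonneg)
  obtain k where k: "finite k" "{S f t |f t. f \<in> \<G>} \<subseteq> (\<Union>x\<in>k. ball x e')"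
    using totally_bounded_S_values e'(1) unfolding totally_bounded_set_def by blast
  have "\<forall>\<^sub>F r in at 0 within {0..}. dist (T r x) x < e / 4" for x
  proof -
    have "continuous_on {0..} (\<lambda>t. T t x)"
      using semigroup by (simp add: C0_semigroup_def)
    then have "((\<lambda>r. T r x) \<longlongrightarrow> T 0 x) (at 0 within {0..})"
      by (simp add: continuous_on_def)
    then show ?thesis
      using e by (intro tendstoD) (auto simp: T_0)
  qed
  then have "\<forall>\<^sub>F r in at 0 within {0..}. \<forall>x\<in>k. dist (T r x) x < e / 4"
    using k(1) by (simp add: eventually_ball_finite)
  then obtain d1 where d1: "d1 > 0" "\<And>r x. r > 0 \<Longrightarrow> r < d1 \<Longrightarrow> x \<in> k \<Longrightarrow> dist (T r x) x < e / 4"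
    unfolding eventually_at by (auto simp: dist_real_def)
  define d where "d = min d1 (e / (2 * (M * B + 1)))"
  have MB: "M * B \<ge> 0" using M_nonneg B_nonneg by simp
  have d: "d > 0" using d1(1) e MB by (simp add: d_def)
  have less: "dist (S f s) (S f t) < e" if f: "f \<in> \<G>" and st: "s < t" "t - s < d" for f s t
  proof -
    let ?z = "S f s" and ?r = "t - s"
    obtain x where x: "x \<in> k" "dist x ?z < e'"
      using k(2) f by force
    have "T ?r ?z - ?z = T ?r (?z - x) + (T ?r x - x) + (x - ?z)"
      by (simp add: blinfun.diff_right)
    then have "norm (T ?r ?z - ?z) \<le> norm (T ?r (?z - x)) + norm (T ?r x - x) + norm (x - ?z)"
      by (metis norm_triangle_ineq norm_triangle_le add_mono order_refl)
    also have "\<dots> \<le> M * e' + e / 4 + e'"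
    proof (intro add_mono)
      show "norm (T ?r (?z - x)) \<le> M * e'"
        using norm_T_apply_le'[of ?r "?z - x"] mult_left_mono[OF less_imp_le[OF x(2)] M_nonneg] st
        by (simp add: dist_norm norm_minus_commute)
      show "norm (T ?r x - x) \<le> e / 4"
        using d1(2)[of ?r x] st x(1) by (simp add: dist_norm d_def)
      show "norm (x - ?z) \<le> e'" using x(2) by (simp add: dist_norm)
    qed
    also have "\<dots> = e / 2" using e'(2) by (simp add: algebra_simps)
    finally have 1: "norm (T ?r ?z - ?z) \<le> e / 2" .
    have "M * B * ?r < e / 2"
    proof -
      have "(M * B + 1) * ?r < e / 2"
        using st MB by (simp add: d_def field_simps)
      with st show ?thesis by (simp add: algebra_simps)
    qed
    then have 2: "norm (S f t - T ?r ?z) < e / 2"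
      using mild_integral_bound[OF bounded_familyD(1)[OF f] bounded_familyD(2)[OF f] bounded_familyD(3)[OF f], of s t] st by simp
    show ?thesis
      using norm_triangle_ineq[of "S f t - T ?r ?z" "T ?r ?z - ?z"] 1 2
      by (simp add: dist_norm norm_minus_commute)
  qed
  show ?thesis
  proof
    show "dist (S f s) (S f t) < e" if "f \<in> \<G>" "\<bar>s - t\<bar> < d" for f s t
      using less[of f s t] less[of f t s] that e by (cases s t rule: linorder_cases) (auto simp: dist_commute)
  qed (rule d)
qed

end

end

section \<open>The nonlinear delay equation\<close>

lemma continuous_on_bcontfun_eval:
  fixes t :: "'a::topological_space"
  shows "continuous_on A (\<lambda>u :: 'a \<Rightarrow>\<^sub>C 'b::metric_space. apply_bcontfun u t)"
  unfolding continuous_on_iff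
  using dist_bounded order_le_less_trans by blast

text \<open>Arzela-Ascoli: each function is coded by net points close to its values on a finite grid
  of one period. There are finitely many codes, and equicontinuity makes functions with equal codes
  uniformly close.\<close>

lemma totally_bounded_set_periodic_bcontfun:
  fixes \<F> :: "(real \<Rightarrow>\<^sub>C 'a::metric_space) set"
  assumes \<omega>: "\<omega> > 0" and per: "\<And>u t. u \<in> \<F> \<Longrightarrow> apply_bcontfun u (t + \<omega>) = apply_bcontfun u t"
    and tb: "totally_bounded_set {apply_bcontfun u t |u t. u \<in> \<F>}"
    and equi: "\<And>e. e > 0 \<Longrightarrow> \<exists>d>0. \<forall>u\<in>\<F>. \<forall>s t. \<bar>s - t\<bar> < d \<longrightarrow> dist (apply_bcontfun u s) (apply_bcontfun u t) < e"
  shows "totally_bounded_set \<F>"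
  unfolding totally_bounded_set_def
proof (intro allI impI)
  fix e :: real assume "e > 0"
  define e' where "e' = e / 5"
  have e': "e' > 0" "4 * e' < e" using \<open>e > 0\<close> by (auto simp: e'_def)
  obtain k where k: "finite k" "{apply_bcontfun u t |u t. u \<in> \<F>} \<subseteq> (\<Union>x\<in>k. ball x e')"
    using tb e'(1) unfolding totally_bounded_set_def by meson
  obtain d where d: "d > 0" "\<And>u s t. u \<in> \<F> \<Longrightarrow> \<bar>s - t\<bar> < d \<Longrightarrow> dist (apply_bcontfun u s) (apply_bcontfun u t) < e'"
    using equi[OF e'(1)] by auto
  obtain G where G: "finite G" "{0..\<omega>} \<subseteq> (\<Union>g\<in>G. ball g d)"
    using compact_Icc[of 0 \<omega>] d(1) unfolding compact_eq_totally_bounded by meson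
  have "\<exists>x\<in>k. dist x (apply_bcontfun u g) < e'" if "u \<in> \<F>" for u g
  proof -
    have "apply_bcontfun u g \<in> (\<Union>x\<in>k. ball x e')"
      by (rule subsetD[OF k(2)]) (use that in blast)
    then show ?thesis by auto
  qed
  then obtain c where c: "\<And>u g. u \<in> \<F> \<Longrightarrow> c u g \<in> k" "\<And>u g. u \<in> \<F> \<Longrightarrow> dist (c u g) (apply_bcontfun u g) < e'"
    by metis
  define code where "code u = restrict (c u) G" for u
  have "code ` \<F> \<subseteq> PiE G (\<lambda>_. k)"
    using c(1) by (auto simp: code_def)
  then have fin: "finite (code ` \<F>)"
    by (rule finite_subset) (intro finite_PiE G k)
  define rep where "rep = inv_into \<F> code"
  have "u \<in> ball (rep (code u)) e" if u: "u \<in> \<F>" for u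
  proof -
    define w where "w = rep (code u)"
    have w: "w \<in> \<F>" "code w = code u"
      unfolding w_def rep_def using u by (auto intro: inv_into_into f_inv_into_f)
    have "dist (apply_bcontfun w t) (apply_bcontfun u t) \<le> 4 * e'" for t
    proof -
      obtain s n where s: "s \<in> {0..\<omega>}" "t = s + real_of_int n * \<omega>"
        using reduce_to_period[OF \<omega>] .
      obtain g where g: "g \<in> G" "\<bar>g - s\<bar> < d"
        using G(2) s(1) by (auto simp: dist_real_def subset_iff)
      have cg: "c w g = c u g"
        using fun_cong[OF w(2), of g] g(1) by (simp add: code_def)
      \<comment> \<open>Four steps of size below \<open>e'\<close>: from \<open>w s\<close> to
        \<open>w g\<close>, to the shared net point, to \<open>u g\<close>, to
        \<open>u s\<close>.\<close>
      have "dist (apply_bcontfun w s) (apply_bcontfun u s) \<le> 4 * e'"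
        using d(2)[OF w(1) g(2)] d(2)[OF u g(2)] c(2)[OF w(1), of g] c(2)[OF u, of g]
          dist_triangle[of "apply_bcontfun w s" "apply_bcontfun u s" "apply_bcontfun w g"]
          dist_triangle[of "apply_bcontfun w g" "apply_bcontfun u s" "c u g"]
          dist_triangle[of "c u g" "apply_bcontfun u s" "apply_bcontfun u g"]
        unfolding cg by (simp add: dist_commute)
      then show ?thesis
        using periodic_int_multiple[of "apply_bcontfun w" \<omega>, OF per[OF w(1)]]
          periodic_int_multiple[of "apply_bcontfun u" \<omega>, OF per[OF u]] s(2) by simp
    qed
    then have "dist w u \<le> 4 * e'"
      by (rule dist_bound)
    with e'(2) show ?thesis by (simp add: w_def)
  qed
  then have "\<F> \<subseteq> (\<Union>x\<in>rep ` code ` \<F>. ball x e)"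
    by blast
  with fin show "\<exists>k. finite k \<and> \<F> \<subseteq> (\<Union>x\<in>k. ball x e)"
    by blast
qed

text \<open>\<open>d\<close> comes from the Lebesgue number lemma for a cover of \<open>C\<close> by
  open sets on which \<open>f\<close> oscillates by less than \<open>e\<close>. Only
  \<open>x\<close> is confined to \<open>C\<close>: a function near a given one need not take its
  values in the compact range of that one.\<close>

lemma continuous_on_uniform_near_compact:
  fixes f :: "'a::metric_space \<Rightarrow> 'b::metric_space"
  assumes f: "continuous_on D f" and C: "compact C" "C \<subseteq> D" and e: "e > 0"
  obtains d where "d > 0" "\<And>x y. x \<in> C \<Longrightarrow> y \<in> D \<Longrightarrow> dist x y < d \<Longrightarrow> dist (f x) (f y) < e"
proof -
  define \<U> where "\<U> = {U. open U \<and> (\<forall>y\<in>U \<inter> D. \<forall>z\<in>U \<inter> D. dist (f y) (f z) < e)}"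
  have "C \<subseteq> \<Union>\<U>"
  proof
    fix x assume "x \<in> C"
    then have "x \<in> D" using C(2) by blast
    then obtain d where d: "d > 0" "\<And>y. y \<in> D \<Longrightarrow> dist y x < d \<Longrightarrow> dist (f y) (f x) < e/2"
      using f e unfolding continuous_on_iff by (meson half_gt_zero)
    have "ball x d \<in> \<U>"
      unfolding \<U>_def
    proof (intro CollectI conjI ballI open_ball)
      fix y z assume "y \<in> ball x d \<inter> D" "z \<in> ball x d \<inter> D"
      then have "dist (f y) (f x) < e/2" "dist (f z) (f x) < e/2"
        using d(2)[of y] d(2)[of z] by (simp_all add: dist_commute[of x])
      then show "dist (f y) (f z) < e"
        by (rule dist_triangle_half_l)
    qed
    with d(1) show "x \<in> \<Union>\<U>" by (auto intro!: bexI[of _ "ball x d"])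
  qed
  moreover have "open U" if "U \<in> \<U>" for U
    using that by (simp add: \<U>_def)
  ultimately obtain d where d: "d > 0" "\<And>x. x \<in> C \<Longrightarrow> \<exists>U\<in>\<U>. ball x d \<subseteq> U"
    using Heine_Borel_lemma[OF C(1)] by metis
  show ?thesis
  proof
    fix x y assume xy: "x \<in> C" "y \<in> D" "dist x y < d"
    then obtain U where U: "U \<in> \<U>" "ball x d \<subseteq> U" using d(2) by blast
    then have "x \<in> U \<inter> D" "y \<in> U \<inter> D"
      using xy C(2) d(1) by auto
    then show "dist (f x) (f y) < e"
      using U(1) by (simp add: \<U>_def)
  qed (rule d(1))
qed

section \<open>Existence of a positive periodic mild solution\<close>

theorem theorem1p1:
  fixes K :: "'a::banach set"
    and A :: "'a \<Rightarrow> 'a" and D :: "'a set"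
    and T :: "real \<Rightarrow> 'a \<Rightarrow>\<^sub>L 'a"
    and F :: "real \<Rightarrow> 'a \<Rightarrow> 'a \<Rightarrow> 'a"
    and h0 :: "real \<Rightarrow> 'a"
    and \<tau> \<omega> C1 C2 :: real
  assumes cone: "closed_convex_cone K" and normal: "normal_cone K"
    and Aop: "closed_linear_operator A D"
    and semigroup: "C0_semigroup T"
    and gen: "is_generator T (\<lambda>x. - A x) D"
    and pos: "positive_semigroup T K"
    and cpt: "compact_semigroup T"
    and stable: "growth_bound T < 0"
    and tau: "\<tau> > 0" and omega: "\<omega> > 0"
    and F_K: "\<And>t x y. x \<in> K \<Longrightarrow> y \<in> K \<Longrightarrow> F t x y \<in> K"
    and F_cont: "continuous_on (UNIV \<times> K \<times> K) (\<lambda>(t, x, y). F t x y)"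
    and F_per: "\<And>t x y. x \<in> K \<Longrightarrow> y \<in> K \<Longrightarrow> F (t + \<omega>) x y = F t x y"
    and C1: "C1 > 0" and C2: "C2 > 0"
    and C12: "ereal (C1 + C2) < - growth_bound T"
    and h0_cont: "continuous_on UNIV h0"
    and h0_per: "\<And>t. h0 (t + \<omega>) = h0 t"
    and h0_K: "\<And>t. h0 t \<in> K"
    and H1: "\<And>t x y. x \<in> K \<Longrightarrow> y \<in> K \<Longrightarrow>
               cone_le K (F t x y) (C1 *\<^sub>R x + C2 *\<^sub>R y + h0 t)"
  shows "\<exists>u. positive_periodic_mild_solution T K F \<tau> \<omega> u"
proof -
  have "growth_bound T < ereal (- (C1 + C2))"
    using C12 by (simp add: ereal_less_uminus_reorder)
  \<comment> \<open>The infimum lies strictly below \<open>- (C1 + C2)\<close>, so some admissible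
    exponent does too.\<close>
  then obtain \<gamma>' M where "\<gamma>' < - (C1 + C2)" and M: "\<forall>t\<ge>0. norm (T t) \<le> M * exp (\<gamma>' * t)"
    unfolding growth_bound_def Inf_less_iff by auto
  define \<gamma> where "\<gamma> = - \<gamma>'"
  have \<gamma>: "C1 + C2 < \<gamma>" using \<open>\<gamma>' < - (C1 + C2)\<close> by (simp add: \<gamma>_def)
  interpret stable_semigroup T M \<gamma> \<omega>
    using semigroup omega M \<gamma> C1 C2 by unfold_locales (auto simp: \<gamma>_def)
  note Kd = closed_convex_coneD[OF cone]
  obtain v where v: "continuous_on UNIV v" "\<And>t. v (t + \<omega>) = v t" "\<And>t. v t \<in> K"
    "\<And>t. v t = S (\<lambda>s. C1 *\<^sub>R v s + C2 *\<^sub>R v (s - \<tau>) + h0 s) t"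
    using linear_delay_solution[OF cone pos less_imp_le[OF C1] less_imp_le[OF C2] \<gamma> h0_cont h0_per h0_K]
    by blast
  \<comment> \<open>The right-hand side of the majorant equation, so \<open>v = S g\<close>.\<close>
  define g where "g s = C1 *\<^sub>R v s + C2 *\<^sub>R v (s - \<tau>) + h0 s" for s
  have g_cont: "continuous_on UNIV g"
    unfolding g_def by (intro continuous_intros h0_cont v(1) continuous_on_compose2[OF v(1)]) auto
  have g_per: "g (s + \<omega>) = g s" for s
    using v(2)[of s] v(2)[of "s - \<tau>"] h0_per[of s] by (simp add: g_def algebra_simps)
  obtain N where N: "N > 0" "\<And>x y. x \<in> K \<Longrightarrow> y - x \<in> K \<Longrightarrow> norm x \<le> N * norm y"
    using normal unfolding normal_cone_def cone_le_def by auto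
  obtain Bg where Bg: "\<And>t. norm (g t) \<le> Bg"
    using periodic_bounded[OF omega g_cont g_per] by blast
  define B where "B = N * Bg"
  have B_nonneg: "B \<ge> 0"
    unfolding B_def using N(1) order_trans[OF norm_ge_zero Bg] by simp

  \<comment> \<open>The order interval from 0 to \<open>v\<close> among periodic functions, inside
    the complete space of bounded continuous functions.\<close>
  define \<Omega> :: "(real \<Rightarrow>\<^sub>C 'a) set"
    where "\<Omega> = {u. \<forall>t. apply_bcontfun u t \<in> K \<and> v t - apply_bcontfun u t \<in> K \<and>
                  apply_bcontfun u (t + \<omega>) = apply_bcontfun u t}"
  define \<Phi> where "\<Phi> u s = F s (apply_bcontfun u s) (apply_bcontfun u (s - \<tau>))" for u s
  have \<Omega>D: "apply_bcontfun u t \<in> K" "v t - apply_bcontfun u t \<in> K" "apply_bcontfun u (t + \<omega>) = apply_bcontfun u t"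
    if "u \<in> \<Omega>" for u t
    using that by (auto simp: \<Omega>_def)
  have \<Phi>_K: "\<Phi> u s \<in> K" if "u \<in> \<Omega>" for u s
    unfolding \<Phi>_def by (intro F_K \<Omega>D that)
  have \<Phi>_per: "\<Phi> u (s + \<omega>) = \<Phi> u s" if "u \<in> \<Omega>" for u s
    using \<Omega>D(3)[OF that, of s] \<Omega>D(3)[OF that, of "s - \<tau>"] F_per[OF \<Omega>D(1) \<Omega>D(1), OF that that, of s s "s - \<tau>"]
    by (simp add: \<Phi>_def algebra_simps)
  have graph_cont: "continuous_on X (\<lambda>s. (s, apply_bcontfun u s, apply_bcontfun u (s - \<tau>)))" for u and X :: "real set"
    by (intro continuous_on_Pair continuous_on_id continuous_on_apply_bcontfun
        continuous_on_compose2[OF continuous_on_apply_bcontfun[of UNIV]] continuous_on_diff continuous_on_const) auto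
  have \<Phi>_cont: "continuous_on UNIV (\<Phi> u)" if "u \<in> \<Omega>" for u
    using continuous_on_compose2[OF F_cont graph_cont[of UNIV u]] \<Omega>D(1)[OF that]
    by (auto simp: \<Phi>_def[abs_def])
  have g_minus_\<Phi>: "g s - \<Phi> u s \<in> K" if u: "u \<in> \<Omega>" for u s
  proof -
    \<comment> \<open>The first bracket is in \<open>K\<close> by (H1) at \<open>u\<close>, the
      second because \<open>u\<close> lies below \<open>v\<close>.\<close>
    have "g s - \<Phi> u s = (C1 *\<^sub>R apply_bcontfun u s + C2 *\<^sub>R apply_bcontfun u (s - \<tau>) + h0 s - \<Phi> u s)
        + (C1 *\<^sub>R (v s - apply_bcontfun u s) + C2 *\<^sub>R (v (s - \<tau>) - apply_bcontfun u (s - \<tau>)))"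
      by (simp add: g_def algebra_simps)
    also have "\<dots> \<in> K"
      using H1[OF \<Omega>D(1)[OF u, of s] \<Omega>D(1)[OF u, of "s - \<tau>"], of s] C1 C2
      by (intro Kd(4,5) \<Omega>D(2)[OF u]) (auto simp: cone_le_def \<Phi>_def)
    finally show ?thesis .
  qed
  \<comment> \<open>Normality of the cone turns the order bound by \<open>g\<close> into a norm
    bound.\<close>
  have \<Phi>_bound: "norm (\<Phi> u s) \<le> B" if "u \<in> \<Omega>" for u s
    using N(2)[OF \<Phi>_K[OF that, of s] g_minus_\<Phi>[OF that, of s]] mult_left_mono[OF Bg[of s] less_imp_le[OF N(1)]]
    by (simp add: B_def)

  \<comment> \<open>\<open>Bcontfun\<close> is meaningful only for bounded continuous arguments;
    \<open>Q_apply\<close> secures this on \<open>\<Omega>\<close>.\<close>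
  define Q where "Q u = Bcontfun (S (\<Phi> u))" for u
  have Q_apply: "apply_bcontfun (Q u) = S (\<Phi> u)" if "u \<in> \<Omega>" for u
    unfolding Q_def
    by (rule Bcontfun_inverse, rule bcontfun_normI[OF S_continuous[OF \<Phi>_cont[OF that]] S_bound[OF \<Phi>_cont[OF that] \<Phi>_bound[OF that]]])
  have Q_\<Omega>: "Q u \<in> \<Omega>" if u: "u \<in> \<Omega>" for u
  proof -
    \<comment> \<open>Linearity and positivity of \<open>S\<close> give the upper bound
      \<open>v\<close>.\<close>
    have "v t - S (\<Phi> u) t = S (\<lambda>s. g s - \<Phi> u s) t" for t
      using v(4)[of t] S_diff[OF g_cont \<Phi>_cont[OF u], of t] by (simp add: g_def[abs_def])
    moreover have "S (\<lambda>s. g s - \<Phi> u s) t \<in> K" for t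
      by (intro S_in_cone continuous_on_diff g_cont \<Phi>_cont[OF u] cone pos g_minus_\<Phi>[OF u])
    moreover have "S (\<Phi> u) t \<in> K" for t
      by (intro S_in_cone \<Phi>_cont[OF u] cone pos \<Phi>_K[OF u])
    moreover have "S (\<Phi> u) (t + \<omega>) = S (\<Phi> u) t" for t
      by (intro S_periodic \<Phi>_per[OF u])
    ultimately show ?thesis
      by (simp add: \<Omega>_def Q_apply[OF u])
  qed

  have "convex \<Omega>"
  proof (rule convexI)
    fix u w and a b :: real assume uw: "u \<in> \<Omega>" "w \<in> \<Omega>" and ab: "0 \<le> a" "0 \<le> b" "a + b = 1"
    have split: "v t - (a *\<^sub>R apply_bcontfun u t + b *\<^sub>R apply_bcontfun w t)
        = a *\<^sub>R (v t - apply_bcontfun u t) + b *\<^sub>R (v t - apply_bcontfun w t)" for t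
      using ab(3) scaleR_left.add[of a b "v t"] by (simp add: algebra_simps)
    show "a *\<^sub>R u + b *\<^sub>R w \<in> \<Omega>"
      unfolding \<Omega>_def using \<Omega>D[OF uw(1)] \<Omega>D[OF uw(2)] ab
      by (auto simp: split intro!: Kd(4,5))
  qed
  moreover have "closed \<Omega>"
  proof -
    have vimage: "closed {u :: real \<Rightarrow>\<^sub>C 'a. f u \<in> K}" if "continuous_on UNIV f" for f
      using closed_vimage[OF Kd(1) that] by (simp add: vimage_def)
    show ?thesis
      unfolding \<Omega>_def
      by (intro closed_Collect_all closed_Collect_conj closed_Collect_eq vimage
          continuous_on_diff continuous_on_const continuous_on_bcontfun_eval)
  qed
  moreover have "\<Omega> \<noteq> {}"
  proof -
    have "0 \<in> \<Omega>" using Kd(3) v(3) by (simp add: \<Omega>_def)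
    then show ?thesis by blast
  qed
  moreover have "continuous_on \<Omega> Q"
    unfolding continuous_on_iff
  proof (intro ballI allI impI)
    fix u and e :: real assume u: "u \<in> \<Omega>" and e: "e > 0"
    define e' where "e' = e * \<gamma> / (M + 1)"
    have e': "e' > 0" using e \<gamma>_pos M_nonneg by (simp add: e'_def)
    \<comment> \<open>The arguments of \<open>F\<close> along \<open>u\<close> over one period form
      a compact set; periodicity extends the estimate to all times.\<close>
    let ?\<Gamma> = "(\<lambda>s. (s, apply_bcontfun u s, apply_bcontfun u (s - \<tau>))) ` {0..\<omega>}"
    have "compact ?\<Gamma>"
      by (intro compact_continuous_image graph_cont compact_Icc)
    moreover have "?\<Gamma> \<subseteq> UNIV \<times> K \<times> K"
      using \<Omega>D(1)[OF u] by auto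
    ultimately obtain d where d: "d > 0"
      "\<And>x y. x \<in> ?\<Gamma> \<Longrightarrow> y \<in> UNIV \<times> K \<times> K \<Longrightarrow> dist x y < d \<Longrightarrow>
        dist ((\<lambda>(t, x, y). F t x y) x) ((\<lambda>(t, x, y). F t x y) y) < e'"
      using continuous_on_uniform_near_compact[OF F_cont _ _ e'] by blast
    \<comment> \<open>Half of \<open>d\<close>, since the present and the delayed value both
      move.\<close>
    have "dist (Q w) (Q u) < e" if w: "w \<in> \<Omega>" and wu: "dist w u < d / 2" for w
    proof -
      have near: "norm (\<Phi> w t - \<Phi> u t) \<le> e'" for t
      proof -
        obtain s k where s: "s \<in> {0..\<omega>}" "t = s + real_of_int k * \<omega>"
          using reduce_to_period[OF omega] .
        have "dist (s, apply_bcontfun u s, apply_bcontfun u (s - \<tau>)) (s, apply_bcontfun w s, apply_bcontfun w (s - \<tau>))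
            \<le> dist (apply_bcontfun u s) (apply_bcontfun w s) + dist (apply_bcontfun u (s - \<tau>)) (apply_bcontfun w (s - \<tau>))"
          by (simp add: dist_Pair_Pair sqrt_sum_squares_le_sum)
        also have "\<dots> < d"
          using dist_bounded[of u s w] dist_bounded[of u "s - \<tau>" w] wu
          by (simp add: dist_commute)
        finally have "dist ((\<lambda>(t, x, y). F t x y) (s, apply_bcontfun u s, apply_bcontfun u (s - \<tau>)))
            ((\<lambda>(t, x, y). F t x y) (s, apply_bcontfun w s, apply_bcontfun w (s - \<tau>))) < e'"
          using s(1) \<Omega>D(1)[OF w] by (intro d(2)) auto
        then have "norm (\<Phi> w s - \<Phi> u s) < e'"
          by (simp add: \<Phi>_def dist_norm norm_minus_commute)
        then show ?thesis
          using periodic_int_multiple[of "\<Phi> w" \<omega>, OF \<Phi>_per[OF w]]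
            periodic_int_multiple[of "\<Phi> u" \<omega>, OF \<Phi>_per[OF u]] s(2) by simp
      qed
      have "dist (apply_bcontfun (Q w) t) (apply_bcontfun (Q u) t) \<le> M * e' / \<gamma>" for t
        using S_bound[OF continuous_on_diff[OF \<Phi>_cont[OF w] \<Phi>_cont[OF u]] near]
        by (simp add: Q_apply u w dist_norm S_diff \<Phi>_cont)
      then have "dist (Q w) (Q u) \<le> M * e' / \<gamma>"
        by (rule dist_bound)
      also have "\<dots> = e * (M / (M + 1))"
        using \<gamma>_pos by (simp add: e'_def)
      also have "\<dots> < e * 1"
        using e M_nonneg by (intro mult_strict_left_mono) simp_all
      also have "\<dots> = e" by simp
      finally show ?thesis .
    qed
    with d(1) show "\<exists>d>0. \<forall>w\<in>\<Omega>. dist w u < d \<longrightarrow> dist (Q w) (Q u) < e"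
      by (intro exI[of _ "d / 2"]) auto
  qed
  moreover have "Q \<in> \<Omega> \<rightarrow> \<Omega>"
    using Q_\<Omega> by blast
  moreover have "totally_bounded_set (Q ` \<Omega>)"
  proof (rule totally_bounded_set_periodic_bcontfun[OF omega])
    have \<Phi>_all: "\<Phi> ` \<Omega> \<subseteq> {f. continuous_on UNIV f \<and> (\<forall>s. f (s + \<omega>) = f s) \<and> (\<forall>s. norm (f s) \<le> B)}"
      using \<Phi>_cont \<Phi>_per \<Phi>_bound by auto
    show "apply_bcontfun u (t + \<omega>) = apply_bcontfun u t" if "u \<in> Q ` \<Omega>" for u t
      using that Q_\<Omega> \<Omega>D(3) by blast
    \<comment> \<open>Reduces the claim to the values of \<open>S\<close> on the bounded family of
      right-hand sides \<open>\<Phi> u\<close>.\<close>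
    have "{apply_bcontfun u t |u t. u \<in> Q ` \<Omega>} = {S f t |f t. f \<in> \<Phi> ` \<Omega>}"
      using Q_apply by (auto simp: image_iff) metis+
    then show "totally_bounded_set {apply_bcontfun u t |u t. u \<in> Q ` \<Omega>}"
      using totally_bounded_S_values[OF cpt \<Phi>_all B_nonneg] by simp
    show "\<exists>d>0. \<forall>u\<in>Q ` \<Omega>. \<forall>s t. \<bar>s - t\<bar> < d \<longrightarrow> dist (apply_bcontfun u s) (apply_bcontfun u t) < e"
      if e: "e > 0" for e
    proof -
      obtain d where "d > 0" "\<And>f s t. f \<in> \<Phi> ` \<Omega> \<Longrightarrow> \<bar>s - t\<bar> < d \<Longrightarrow> dist (S f s) (S f t) < e"
        using equicontinuous_S[OF cpt \<Phi>_all B_nonneg e] by blast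
      then show ?thesis
        using Q_apply by (intro exI[of _ d]) auto
    qed
  qed
  ultimately obtain u where u: "u \<in> \<Omega>" "Q u = u"
    by (rule schauder_fixpoint)
  then have u_eq: "S (\<Phi> u) = apply_bcontfun u"
    using Q_apply by metis
  have "positive_periodic_mild_solution T K F \<tau> \<omega> (apply_bcontfun u)"
    unfolding positive_periodic_mild_solution_def
    using \<Omega>D[OF u(1)] S_mild[OF \<Phi>_cont[OF u(1)] \<Phi>_per[OF u(1)], unfolded u_eq, unfolded \<Phi>_def]
    by simp
  then show ?thesis by blast
qed

end
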